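(* Let $a:\mathcal{H}\times\mathcal{H}\to\mathbb{C}$ be a sesquilinear form that is continuous with constant $C_{\rm cont}$, satisfies the G\aa rding inequality with constants $C_{G1},C_{G2}$, and satisfies the elliptic-regularity assumption (ER) with constant $C_{\rm ell,1}$ for some $\ell\in\mathbb{Z}^+=\{1,2,\dots\}$ (all as defined in the context). Suppose that the variational problem: given $g\in\mathcal{H}^*$, find $u\in\mathcal{H}$ such that $$a(u,v)=\langle g,v\rangle\quad\text{for all }v\in\mathcal{H}, \qquad (1)$$ has a unique solution. Define $\mathcal{R}^*:\mathcal{H}^*\to\mathcal{H}$ by $$a(w,\mathcal{R}^*v)=\langle w,v\rangle\quad\text{for all }w\in\mathcal{H},\ v\in\mathcal{H}^*,$$ and $$\eta(\mathcal{H}_h):=\|(I-\Pi_h)\mathcal{R}^*\|_{\mathcal{H}_0\to\mathcal{H}},$$ where $\Pi_h:\mathcal{H}\to\mathcal{H}_h$ is the orthogonal projection. Then there exist $C_1,C_2,C_3>0$, depending only on $C_{\rm cont},C_{G1},C_{G2},C_{\rm ell,1}$, and $\ell$, such that if $h$ satisfies $$\eta(\mathcal{H}_h)\,\|I-\Pi_h\|_{\mathcal{Z}_{\ell+1}\to\mathcal{H}}\le C_1, \qquad (2)$$ then the solution $u_h\in\mathcal{H}_h$ of the Galerkin equations $$a(u_h,v_h)=\langle g,v_h\rangle\quad\text{for all }v_h\in\mathcal{H}_h$$ exists, is unique, and satisfies $$\|u-u_h\|_{\mathcal{H}}\le C_2\big(1+\eta(\mathcal{H}_h)\big)\|(I-\Pi_h)u\|_{\mathcal{H}},\qquad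 \|u-u_h\|_{\mathcal{H}_0}\le C_3\,\eta(\mathcal{H}_h)\,\|(I-\Pi_h)u\|_{\mathcal{H}}.$$ In addition, for all $C_{\rm osc}>0$ there exists $C_4>0$, depending only on $C_{\rm cont},C_{G1},C_{G2},C_{\rm ell,1}$, $\ell$, and $C_{\rm osc}$, such that if $$\|g\|_{\mathcal{Z}_{\ell-1}}\le C_{\rm osc}\|g\|_{\mathcal{H}^*}$$ and $h$ satisfies (2), then $$\frac{\|u-u_h\|_{\mathcal{H}}}{\|u\|_{\mathcal{H}}}\le C_4\big(1+\eta(\mathcal{H}_h)\big)\|I-\Pi_h\|_{\mathcal{Z}_{\ell+1}\to\mathcal{H}};$$ i.e., the relative error in $\mathcal{H}$ can be made controllably small by making $\eta(\mathcal{H}_h)\|I-\Pi_h\|_{\mathcal{Z}_{\ell+1}\to\mathcal{H}}$ sufficiently small.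
   Context: Setting. $\mathcal{H}\subset\mathcal{H}_0\subset\mathcal{H}^*$ are Hilbert spaces, $\mathcal{H}^*$ is the space of anti-linear functionals on $\mathcal{H}$, $\mathcal{H}_0$ is identified with its dual, and the inclusion $\mathcal{H}\subset\mathcal{H}_0$ is compact. $\langle\cdot,\cdot\rangle$ is the duality pairing between $\mathcal{H}^*$ and $\mathcal{H}$; for $w\in\mathcal{H}$, $v\in\mathcal{H}^*$, $\langle w,v\rangle$ means $\overline{\langle v,w\rangle}$. Sesquilinear means linear in the first argument and anti-linear in the second. $\{\mathcal{H}_h\}_{h>0}$ is a sequence of finite-dimensional subspaces of $\mathcal{H}$. Continuity: $|a(u,v)|\le C_{\rm cont}\|u\|_{\mathcal{H}}\|v\|_{\mathcal{H}}$ for all $u,v\in\mathcal{H}$, where $C_{\rm cont}>0$. G\aa rding inequality: $\Re a(v,v)\ge C_{G1}\|v\|_{\mathcal{H}}^2-C_{G2}\|v\|_{\mathcal{H}_0}^2$ for all $v\in\mathcal{H}$, where $C_{G1},C_{G2}>0$. Assumption (ER) for $\ell$: $\mathcal{Z}_0=\mathcal{H}_0$, $\mathcal{Z}_1=\mathcal{H}$, and the spaces $\mathcal{Z}_j\subset\mathcal{Z}_{j-1}$, $j=2,\dots,\ell+1$ (with norms $\|\cdot\|_{\mathcal{Z}_j}$), are such that $\mathcal{Z}_j$ is dense in $\mathcal{Z}_{j-1}$. There exists $C_{\rm ell,1}>0$ such that, for all $u\in\mathcal{H}$ and $j=2,\dots,\ell+1$, $$\|u\|_{\mathcal{Z}_j}\le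 C_{\rm ell,1}\Big(\|u\|_{\mathcal{H}_0}+\sup_{v\in\mathcal{H},\ \|v\|_{(\mathcal{Z}_{j-2})^*}=1}|a(u,v)|\Big),$$ with $u\in\mathcal{Z}_j$ if the right-hand side is finite; and, for all $u\in\mathcal{H}$ and $j=2,\dots,\ell+1$, $$\|u\|_{\mathcal{Z}_j}\le C_{\rm ell,1}\Big(\|u\|_{\mathcal{H}_0}+\sup_{v\in\mathcal{H},\ \|v\|_{(\mathcal{Z}_{j-2})^*}=1}|(\Re a)(u,v)|\Big),$$ with $u\in\mathcal{Z}_j$ if the right-hand side is finite, where $(\Re a)(u,v):=\tfrac12\big(a(u,v)+\overline{a(v,u)}\big)$. Here $\|\cdot\|_{(\mathcal{Z}_m)^*}$ is the dual norm with respect to the $\mathcal{H}_0$ pairing: for $v\in\mathcal{H}$, $\|v\|_{(\mathcal{Z}_m)^*}=\sup_{w\in\mathcal{Z}_m,\,\|w\|_{\mathcal{Z}_m}=1}|\langle v,w\rangle_{\mathcal{H}_0}|$.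
   Formalization: The constants C_1,…,C_4 may additionally depend on a bound C_emb for the norm of the inclusion H ⊂ H_0 (‖v‖_{H_0} ≤ C_emb‖v‖_H); without this the claim is false. All spaces lie in one ambient vector space, which can be taken to hold copies of all cases. *)

theory Defs
  imports "HOL-Analysis.Analysis"
begin

(* All spaces are linear subspaces of one complex vector space, given by a type
   'v::ab_group_add together with a scalar multiplication smul (library locale vector_space).
   Carriers, inner products and norms are ordinary variables, so that one can quantify over them
   after the constants have been chosen. *)

definition ip_norm :: "('v \<Rightarrow> 'v \<Rightarrow> complex) \<Rightarrow> 'v \<Rightarrow> real" where
  "ip_norm ip x = sqrt (Re (ip x x))"

locale complex_hilbert_space = vector_space smul
  for smul :: "complex \<Rightarrow> 'v::ab_group_add \<Rightarrow> 'v" +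
  fixes S :: "'v set" and ip :: "'v \<Rightarrow> 'v \<Rightarrow> complex"
  assumes subspace_carrier: "subspace S"
    and ip_add_left: "\<And>x y z. x \<in> S \<Longrightarrow> y \<in> S \<Longrightarrow> z \<in> S \<Longrightarrow> ip (x + y) z = ip x z + ip y z"
    and ip_scale_left: "\<And>c x y. x \<in> S \<Longrightarrow> y \<in> S \<Longrightarrow> ip (smul c x) y = c * ip x y"
    and ip_commute: "\<And>x y. x \<in> S \<Longrightarrow> y \<in> S \<Longrightarrow> ip y x = cnj (ip x y)"
    and ip_pos: "\<And>x. x \<in> S \<Longrightarrow> x \<noteq> 0 \<Longrightarrow> Re (ip x x) > 0"
    and complete: "\<And>X :: nat \<Rightarrow> 'v. (\<forall>n. X n \<in> S) \<Longrightarrow>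
          (\<forall>e>0. \<exists>M. \<forall>m\<ge>M. \<forall>n\<ge>M. ip_norm ip (X m - X n) < e) \<Longrightarrow>
          \<exists>x\<in>S. (\<lambda>n. ip_norm ip (X n - x)) \<longlonglongrightarrow> 0"

locale complex_normed_space = vector_space smul
  for smul :: "complex \<Rightarrow> 'v::ab_group_add \<Rightarrow> 'v" +
  fixes S :: "'v set" and N :: "'v \<Rightarrow> real"
  assumes subspace_carrier: "subspace S"
    and norm_nonneg: "\<And>x. x \<in> S \<Longrightarrow> N x \<ge> 0"
    and norm_eq_0: "\<And>x. x \<in> S \<Longrightarrow> N x = 0 \<longleftrightarrow> x = 0"
    and norm_scale: "\<And>c x. x \<in> S \<Longrightarrow> N (smul c x) = cmod c * N x"
    and norm_triangle: "\<And>x y. x \<in> S \<Longrightarrow> y \<in> S \<Longrightarrow> N (x + y) \<le> N x + N y"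

(* Norm of f : (S, N) \<rightarrow> (_, M).  It is extended-valued, so an unbounded f has norm infinity,
   and the supremum over an empty unit sphere is 0. *)
definition op_norm :: "'v set \<Rightarrow> ('v \<Rightarrow> real) \<Rightarrow> ('w \<Rightarrow> real) \<Rightarrow> ('v \<Rightarrow> 'w) \<Rightarrow> ennreal" where
  "op_norm S N M f = (SUP x\<in>{x \<in> S. N x = 1}. ennreal (M (f x)))"

(* A functional g is a function on the ambient type of which only the values on H matter;
   the pairing of g with v is g v. *)
definition antidual ::
  "(complex \<Rightarrow> 'v::ab_group_add \<Rightarrow> 'v) \<Rightarrow> 'v set \<Rightarrow> ('v \<Rightarrow> 'v \<Rightarrow> complex) \<Rightarrow> ('v \<Rightarrow> complex) set" where
  "antidual smul H ipH = {g.
     (\<forall>x\<in>H. \<forall>y\<in>H. g (x + y) = g x + g y) \<and>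
     (\<forall>c. \<forall>x\<in>H. g (smul c x) = cnj c * g x) \<and>
     (\<exists>B. \<forall>x\<in>H. cmod (g x) \<le> B * ip_norm ipH x)}"

definition antidual_norm :: "'v set \<Rightarrow> ('v \<Rightarrow> 'v \<Rightarrow> complex) \<Rightarrow> ('v \<Rightarrow> complex) \<Rightarrow> ennreal" where
  "antidual_norm H ipH g = op_norm H (ip_norm ipH) cmod g"

(* x \<in> H0 is identified with the functional ip0 x = (\<lambda>v. ip0 x v) on H.  The assumption
   antidual_inclusion says that this identification is injective, i.e. that H0 is included in H*
   (H is dense in H0).

   Cemb bounds the norm of the (compact, hence bounded) inclusion H \<subseteq> H0.  It has to be named
   because the constants of the Galerkin error bounds cannot be chosen independently of it:
   on complex pairs take ipH u v = u1 cnj v1 + u2 cnj v2, ip0 u v = u1 cnj v1 + K^2 u2 cnj v2,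
   a u v = u1 cnj v2 - u2 cnj v1, Z_2 = (H0, ip_norm ip0), and the discrete space
   spanned by (1,0).  Continuity, the Garding inequality (both its constants 1) and elliptic
   regularity (l = 1, constant 1) hold for every K \<ge> 1, and the product of the adjoint
   approximability 1 and of the norm 1/K of I - Pi : Z_2 \<rightarrow> H tends to 0 as K grows, while
   the Galerkin matrix is 0. *)
locale hilbert_triple =
  sp0: complex_hilbert_space smul H0 ip0 + sp1: complex_hilbert_space smul H ipH
  for smul :: "complex \<Rightarrow> 'v::ab_group_add \<Rightarrow> 'v"
    and H0 :: "'v set" and ip0 :: "'v \<Rightarrow> 'v \<Rightarrow> complex"
    and H :: "'v set" and ipH :: "'v \<Rightarrow> 'v \<Rightarrow> complex" +
  fixes Cemb :: real
  assumes inclusion: "H \<subseteq> H0"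
    and antidual_inclusion: "\<And>x. x \<in> H0 \<Longrightarrow> (\<forall>v\<in>H. ip0 x v = 0) \<Longrightarrow> x = 0"
    and compact_inclusion: "\<And>X :: nat \<Rightarrow> 'v. (\<forall>n. X n \<in> H) \<Longrightarrow>
          (\<exists>B. \<forall>n. ip_norm ipH (X n) \<le> B) \<Longrightarrow>
          \<exists>r x. strict_mono r \<and> x \<in> H0 \<and> (\<lambda>n. ip_norm ip0 (X (r n) - x)) \<longlonglongrightarrow> 0"
    and inclusion_bound: "\<And>v. v \<in> H \<Longrightarrow> ip_norm ip0 v \<le> Cemb * ip_norm ipH v"

definition sesquilinear_on ::
  "(complex \<Rightarrow> 'v::ab_group_add \<Rightarrow> 'v) \<Rightarrow> 'v set \<Rightarrow> ('v \<Rightarrow> 'v \<Rightarrow> complex) \<Rightarrow> bool" where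
  "sesquilinear_on smul H a \<longleftrightarrow>
     (\<forall>x\<in>H. \<forall>y\<in>H. \<forall>v\<in>H. a (x + y) v = a x v + a y v \<and> a v (x + y) = a v x + a v y) \<and>
     (\<forall>c. \<forall>x\<in>H. \<forall>v\<in>H. a (smul c x) v = c * a x v \<and> a v (smul c x) = cnj c * a v x)"

definition continuous_form ::
  "'v set \<Rightarrow> ('v \<Rightarrow> 'v \<Rightarrow> complex) \<Rightarrow> real \<Rightarrow> ('v \<Rightarrow> 'v \<Rightarrow> complex) \<Rightarrow> bool" where
  "continuous_form H ipH Ccont a \<longleftrightarrow>
     (\<forall>u\<in>H. \<forall>v\<in>H. cmod (a u v) \<le> Ccont * ip_norm ipH u * ip_norm ipH v)"

definition garding ::
  "('v \<Rightarrow> 'v \<Rightarrow> complex) \<Rightarrow> 'v set \<Rightarrow> ('v \<Rightarrow> 'v \<Rightarrow> complex) \<Rightarrow> real \<Rightarrow> real \<Rightarrow>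
   ('v \<Rightarrow> 'v \<Rightarrow> complex) \<Rightarrow> bool" where
  "garding ip0 H ipH CG1 CG2 a \<longleftrightarrow>
     (\<forall>v\<in>H. Re (a v v) \<ge> CG1 * (ip_norm ipH v)\<^sup>2 - CG2 * (ip_norm ip0 v)\<^sup>2)"

definition re_form :: "('v \<Rightarrow> 'v \<Rightarrow> complex) \<Rightarrow> 'v \<Rightarrow> 'v \<Rightarrow> complex" where
  "re_form a u v = (a u v + cnj (a v u)) / 2"

(* Dual norm of v with respect to the H0 pairing; (Zm, N) is one of the spaces Z_m. *)
definition pairing_dual_norm ::
  "('v \<Rightarrow> 'v \<Rightarrow> complex) \<Rightarrow> 'v set \<Rightarrow> ('v \<Rightarrow> real) \<Rightarrow> 'v \<Rightarrow> ennreal" where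
  "pairing_dual_norm ip0 Zm N v = op_norm Zm N cmod (\<lambda>w. ip0 v w)"

definition regularity_bound ::
  "('v \<Rightarrow> 'v \<Rightarrow> complex) \<Rightarrow> 'v set \<Rightarrow> (nat \<Rightarrow> 'v set) \<Rightarrow> (nat \<Rightarrow> 'v \<Rightarrow> real) \<Rightarrow> real \<Rightarrow>
   ('v \<Rightarrow> 'v \<Rightarrow> complex) \<Rightarrow> nat \<Rightarrow> 'v \<Rightarrow> ennreal" where
  "regularity_bound ip0 H Z nZ Cell b j u =
     ennreal Cell * (ennreal (ip_norm ip0 u) +
       (SUP v\<in>{v \<in> H. pairing_dual_norm ip0 (Z (j - 2)) (nZ (j - 2)) v = 1}. ennreal (cmod (b u v))))"

definition elliptic_regularity ::
  "(complex \<Rightarrow> 'v::ab_group_add \<Rightarrow> 'v) \<Rightarrow> 'v set \<Rightarrow> ('v \<Rightarrow> 'v \<Rightarrow> complex) \<Rightarrow> 'v set \<Rightarrow>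
   ('v \<Rightarrow> 'v \<Rightarrow> complex) \<Rightarrow> (nat \<Rightarrow> 'v set) \<Rightarrow> (nat \<Rightarrow> 'v \<Rightarrow> real) \<Rightarrow> real \<Rightarrow> nat \<Rightarrow>
   ('v \<Rightarrow> 'v \<Rightarrow> complex) \<Rightarrow> bool" where
  "elliptic_regularity smul H0 ip0 H ipH Z nZ Cell l a \<longleftrightarrow>
     Z 0 = H0 \<and> (\<forall>x\<in>H0. nZ 0 x = ip_norm ip0 x) \<and>
     Z 1 = H \<and> (\<forall>x\<in>H. nZ 1 x = ip_norm ipH x) \<and>
     (\<forall>j\<in>{2..l + 1}.
        complex_normed_space smul (Z j) (nZ j) \<and> Z j \<subseteq> Z (j - 1) \<and>
        (\<forall>x\<in>Z (j - 1). \<forall>e>0. \<exists>y\<in>Z j. nZ (j - 1) (x - y) < e)) \<and>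
     (\<forall>b\<in>{a, re_form a}. \<forall>u\<in>H. \<forall>j\<in>{2..l + 1}.
        regularity_bound ip0 H Z nZ Cell b j u < \<infinity> \<longrightarrow>
        u \<in> Z j \<and> ennreal (nZ j u) \<le> regularity_bound ip0 H Z nZ Cell b j u)"

(* With V = H this is the variational problem, with V a discrete space the Galerkin equations. *)
definition solves ::
  "('v \<Rightarrow> 'v \<Rightarrow> complex) \<Rightarrow> 'v set \<Rightarrow> ('v \<Rightarrow> complex) \<Rightarrow> 'v \<Rightarrow> bool" where
  "solves a V g u \<longleftrightarrow> u \<in> V \<and> (\<forall>v\<in>V. a u v = g v)"

(* The pairing of w \<in> H with v \<in> H* (in this order) is cnj (v w). *)
definition adjoint_solution ::
  "'v set \<Rightarrow> ('v \<Rightarrow> 'v \<Rightarrow> complex) \<Rightarrow> ('v \<Rightarrow> complex) \<Rightarrow> 'v" where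
  "adjoint_solution H a v = (THE z. z \<in> H \<and> (\<forall>w\<in>H. a w z = cnj (v w)))"

definition orth_proj ::
  "('v::ab_group_add \<Rightarrow> 'v \<Rightarrow> complex) \<Rightarrow> 'v set \<Rightarrow> 'v \<Rightarrow> 'v" where
  "orth_proj ip V x = (THE y. y \<in> V \<and> (\<forall>w\<in>V. ip (x - y) w = 0))"

definition proj_error ::
  "('v::ab_group_add \<Rightarrow> 'v \<Rightarrow> complex) \<Rightarrow> 'v set \<Rightarrow> 'v \<Rightarrow> 'v" where
  "proj_error ip V x = x - orth_proj ip V x"

definition adjoint_approximability ::
  "'v::ab_group_add set \<Rightarrow> ('v \<Rightarrow> 'v \<Rightarrow> complex) \<Rightarrow> 'v set \<Rightarrow> ('v \<Rightarrow> 'v \<Rightarrow> complex) \<Rightarrow>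
   ('v \<Rightarrow> 'v \<Rightarrow> complex) \<Rightarrow> 'v set \<Rightarrow> ennreal" where
  "adjoint_approximability H0 ip0 H ipH a V =
     op_norm H0 (ip_norm ip0) (ip_norm ipH) (\<lambda>x. proj_error ipH V (adjoint_solution H a (ip0 x)))"

locale galerkin_setting = hilbert_triple smul H0 ip0 H ipH Cemb
  for Ccont CG1 CG2 Cell Cemb :: real and l :: nat
    and smul :: "complex \<Rightarrow> 'v::ab_group_add \<Rightarrow> 'v"
    and H0 :: "'v set" and ip0 :: "'v \<Rightarrow> 'v \<Rightarrow> complex"
    and H :: "'v set" and ipH :: "'v \<Rightarrow> 'v \<Rightarrow> complex" +
  fixes Z :: "nat \<Rightarrow> 'v set" and nZ :: "nat \<Rightarrow> 'v \<Rightarrow> real"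
    and a :: "'v \<Rightarrow> 'v \<Rightarrow> complex"
    and Hh :: "real \<Rightarrow> 'v set"
  assumes sesquilinear: "sesquilinear_on smul H a"
    and continuous: "continuous_form H ipH Ccont a"
    and garding_ineq: "garding ip0 H ipH CG1 CG2 a"
    and regularity: "elliptic_regularity smul H0 ip0 H ipH Z nZ Cell l a"
    and unique_solvability: "\<And>g. g \<in> antidual smul H ipH \<Longrightarrow> \<exists>!u. solves a H g u"
    and discrete_spaces: "\<And>h. h > 0 \<Longrightarrow> Hh h \<subseteq> H \<and> (\<exists>B. finite B \<and> Hh h = module.span smul B)"

end

(* The form is made coercive by a smoothing perturbation and the Galerkin error is estimated by
   duality against the perturbed form.  With lam = CG2 + 1 the hermitian form re_form a + lam * ip0
   is coercive; let T be its solution operator on H0, a self-adjoint contraction.  The perturbation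
   is S = K * T^(l+1), used in place of a spectral cut-off: elliptic regularity for re_form a makes
   S smoothing, while log-convexity of the moments (T^m x, x) yields
   lam * |x|^2 <= Re (energy x x) / 2 + (S x, x) for a suitable K, so that
   b = a + (S ., .) is coercive on H.

   For the Galerkin error e let z = R* e, let zh be its b-adjoint projection onto the discrete space,
   and let w solve b(w, .) = (S e, .).  Then |e|^2 = a(e, z - zh) = b(u - w, z - zh).  By the
   orthogonality of z - zh, the arguments u and w may be replaced by (I - Pi) u and (I - Pi) w, and
   the second contribution is absorbed because w is bounded in Z_(l+1) by |e|. *)

theory Submission
  imports Defs
begin

text \<open>The obstacle is that \<open>a\<close> is not coercive: the usual duality argument, run
  with a best approximation of \<open>z\<close>, closes only if the adjoint approximability
  \<open>\<eta>\<close> is itself small. For the coercive form \<open>b\<close> the projection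
  \<open>zh\<close> is quasi-optimal at once, but bounding the added term
  \<open>(S e, z - zh)\<close> directly by the norms of \<open>S e\<close> and \<open>z - zh\<close>
  would again ask for small \<open>\<eta>\<close>. Representing that term by \<open>w\<close> brings
  in a second projection error, and it is this factor that supplies the norm of
  \<open>I - Pi\<close> on \<open>Z (l + 1)\<close>, so that the hypothesis bears on the product
  alone. The constants may depend only on the given ones, so nothing about individual eigenvalues
  may enter \<open>K\<close>. Powers of \<open>T\<close> meet this demand: regularity bounds them
  with explicit constants, and coercivity fails only where the energy is small relative to the
  \<open>H0\<close> norm, where \<open>T\<close> is not small. The moment inequality makes this
  quantitative through a free parameter that trades energy against smoothing.\<close>

text \<open>Energy arguments end in quadratic bounds such as \<open>n * n \<le> C * n\<close>; this
  removes one factor \<open>n\<close>, with the case \<open>n = 0\<close> left to the third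
  premise.\<close>

lemma cancel_nonneg_factor:
  fixes x y z :: real
  assumes "x * z \<le> y * z" "0 \<le> z" "z = 0 \<Longrightarrow> x \<le> y"
  shows "x \<le> y"
  using assms by (cases "z = 0") auto

section \<open>Normed spaces on a carrier\<close>

context complex_normed_space
begin

lemma mem_closed [simp]:
  shows "0 \<in> S"
    and "x \<in> S \<Longrightarrow> y \<in> S \<Longrightarrow> x + y \<in> S"
    and "x \<in> S \<Longrightarrow> y \<in> S \<Longrightarrow> x - y \<in> S"
    and "x \<in> S \<Longrightarrow> - x \<in> S"
    and "x \<in> S \<Longrightarrow> smul c x \<in> S"
  using subspace_carrier subspace_0 subspace_add subspace_diff subspace_neg subspace_scale by auto

lemma norm_zero [simp]: "N 0 = 0"
  using norm_eq_0[of 0] by simp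

lemma norm_minus: "x \<in> S \<Longrightarrow> N (- x) = N x"
  using norm_scale[of x "-1"] by simp

lemma norm_triangle_diff: "x \<in> S \<Longrightarrow> y \<in> S \<Longrightarrow> N (x - y) \<le> N x + N y"
  using norm_triangle[of x "- y"] norm_minus[of y] by simp

lemma norm_commute: "x \<in> S \<Longrightarrow> y \<in> S \<Longrightarrow> N (x - y) = N (y - x)"
  using norm_minus[of "x - y"] by simp

lemma norm_triangle_sub: "x \<in> S \<Longrightarrow> y \<in> S \<Longrightarrow> N x \<le> N (x - y) + N y"
  using norm_triangle[of "x - y" y] by simp

lemma norm_of_limit:
  assumes "\<And>n. X n \<in> S" "x \<in> S" "(\<lambda>n. N (X n - x)) \<longlonglongrightarrow> 0"
  shows "(\<lambda>n. N (X n)) \<longlonglongrightarrow> N x"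
proof -
  have "\<bar>N (X n) - N x\<bar> \<le> N (X n - x)" for n
    using norm_triangle_sub[of "X n" x] norm_triangle_sub[of x "X n"] norm_commute[of x "X n"] assms
    by (simp add: abs_le_iff)
  then have "(\<lambda>n. N (X n) - N x) \<longlonglongrightarrow> 0"
    by (intro Lim_null_comparison[OF _ assms(3)]) simp
  then show ?thesis
    by (simp add: LIM_zero_iff)
qed

text \<open>Positive homogeneity along the ray through \<open>x\<close> moves \<open>x\<close> to
  the unit sphere, the only place where \<open>op_norm\<close> looks. The bound stays in
  \<open>ennreal\<close> because the operator norm may be infinite.\<close>

lemma op_norm_bound:
  assumes x: "x \<in> S"
    and scale: "\<And>r. r > 0 \<Longrightarrow> M (f (smul (complex_of_real r) x)) = r * M (f x)"
    and zero: "M (f 0) = 0"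
  shows "ennreal (M (f x)) \<le> op_norm S N M f * ennreal (N x)"
proof (cases "x = 0")
  case True
  then show ?thesis using zero by simp
next
  case False
  then have Nx: "N x > 0"
    using norm_nonneg[OF x] norm_eq_0[OF x] by linarith
  define y where "y = smul (complex_of_real (1 / N x)) x"
  have "y \<in> S" "N y = 1"
    using x Nx by (auto simp: y_def norm_scale simp flip: of_real_divide)
  then have "ennreal (M (f y)) \<le> op_norm S N M f"
    unfolding op_norm_def by (intro SUP_upper) auto
  then have "ennreal (M (f y)) * ennreal (N x) \<le> op_norm S N M f * ennreal (N x)"
    by (rule mult_right_mono) simp
  moreover have "M (f y) * N x = M (f x)"
    using scale[of "1 / N x"] Nx by (simp add: y_def)
  ultimately show ?thesis
    using Nx by (metis ennreal_mult'' less_le)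
qed

end

section \<open>Sesquilinear forms on a subspace\<close>

lemma sesquilinear_onI [intro?]:
  assumes "\<And>x y v. x \<in> H \<Longrightarrow> y \<in> H \<Longrightarrow> v \<in> H \<Longrightarrow> b (x + y) v = b x v + b y v"
    and "\<And>x y v. x \<in> H \<Longrightarrow> y \<in> H \<Longrightarrow> v \<in> H \<Longrightarrow> b v (x + y) = b v x + b v y"
    and "\<And>c x v. x \<in> H \<Longrightarrow> v \<in> H \<Longrightarrow> b (smul c x) v = c * b x v"
    and "\<And>c x v. x \<in> H \<Longrightarrow> v \<in> H \<Longrightarrow> b v (smul c x) = cnj c * b v x"
  shows "sesquilinear_on smul H b"
  using assms unfolding sesquilinear_on_def by blast

lemma sesquilinear_onD:
  assumes "sesquilinear_on smul H b"
  shows "x \<in> H \<Longrightarrow> y \<in> H \<Longrightarrow> v \<in> H \<Longrightarrow> b (x + y) v = b x v + b y v"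
    and "x \<in> H \<Longrightarrow> y \<in> H \<Longrightarrow> v \<in> H \<Longrightarrow> b v (x + y) = b v x + b v y"
    and "x \<in> H \<Longrightarrow> v \<in> H \<Longrightarrow> b (smul c x) v = c * b x v"
    and "x \<in> H \<Longrightarrow> v \<in> H \<Longrightarrow> b v (smul c x) = cnj c * b v x"
  using assms unfolding sesquilinear_on_def by blast+

lemma sesquilinear_on_zero:
  assumes "sesquilinear_on smul V b" "vector_space smul" "module.subspace smul V" "v \<in> V"
  shows "b 0 v = 0" "b v 0 = 0"
proof -
  interpret vector_space smul by (rule assms)
  show "b 0 v = 0" "b v 0 = 0"
    using sesquilinear_onD(3,4)[OF assms(1), of 0 v 0] subspace_0[OF assms(3)] assms(4) by auto
qed

lemma sesquilinear_on_diff: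
  assumes "sesquilinear_on smul V b" "vector_space smul" "module.subspace smul V"
    and "x \<in> V" "y \<in> V" "v \<in> V"
  shows "b (x - y) v = b x v - b y v" "b v (x - y) = b v x - b v y"
proof -
  interpret vector_space smul by (rule assms)
  have xy: "x - y \<in> V" using assms subspace_diff by blast
  show "b (x - y) v = b x v - b y v"
    using sesquilinear_onD(1)[OF assms(1) xy assms(5,6)] by simp
  show "b v (x - y) = b v x - b v y"
    using sesquilinear_onD(2)[OF assms(1) xy assms(5,6)] by simp
qed

lemma sesquilinear_on_subset:
  "sesquilinear_on smul H b \<Longrightarrow> V \<subseteq> H \<Longrightarrow> sesquilinear_on smul V b"
  unfolding sesquilinear_on_def by blast

section \<open>Inner product geometry and representation theorems\<close>

context complex_hilbert_space
begin

lemma mem_closed [simp]: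
  shows "0 \<in> S"
    and "x \<in> S \<Longrightarrow> y \<in> S \<Longrightarrow> x + y \<in> S"
    and "x \<in> S \<Longrightarrow> y \<in> S \<Longrightarrow> x - y \<in> S"
    and "x \<in> S \<Longrightarrow> - x \<in> S"
    and "x \<in> S \<Longrightarrow> smul c x \<in> S"
  using subspace_carrier subspace_0 subspace_add subspace_diff subspace_neg subspace_scale by auto

lemma sesquilinear_ip: "sesquilinear_on smul S ip"
proof
  fix x y v assume *: "x \<in> S" "y \<in> S" "v \<in> S"
  show "ip (x + y) v = ip x v + ip y v" by (rule ip_add_left[OF *])
  show "ip v (x + y) = ip v x + ip v y"
    using * ip_commute[of "x + y" v] ip_commute[of x v] ip_commute[of y v] ip_add_left[of x y v]
    by simp
next
  fix c x v assume *: "x \<in> S" "v \<in> S"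
  show "ip (smul c x) v = c * ip x v" by (rule ip_scale_left[OF *])
  show "ip v (smul c x) = cnj c * ip v x"
    using * ip_commute[of "smul c x" v] ip_commute[of x v] ip_scale_left[of x v c]
    by simp
qed

lemmas ip_add_right = sesquilinear_onD(2)[OF sesquilinear_ip]
  and ip_scale_right = sesquilinear_onD(4)[OF sesquilinear_ip]
  and ip_zero [simp] = sesquilinear_on_zero[OF sesquilinear_ip vector_space_axioms subspace_carrier]
  and ip_diff_left = sesquilinear_on_diff(1)[OF sesquilinear_ip vector_space_axioms subspace_carrier]
  and ip_diff_right = sesquilinear_on_diff(2)[OF sesquilinear_ip vector_space_axioms subspace_carrier]

lemma ip_nonneg: "x \<in> S \<Longrightarrow> 0 \<le> Re (ip x x)"
  using ip_pos[of x] by (cases "x = 0") auto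

lemma ip_norm_nonneg [simp]: "x \<in> S \<Longrightarrow> 0 \<le> ip_norm ip x"
  by (simp add: ip_norm_def ip_nonneg)

lemma ip_norm_power2: "x \<in> S \<Longrightarrow> (ip_norm ip x)\<^sup>2 = Re (ip x x)"
  by (simp add: ip_norm_def ip_nonneg)

lemma ip_self: "x \<in> S \<Longrightarrow> ip x x = complex_of_real ((ip_norm ip x)\<^sup>2)"
  using ip_commute[of x x] by (simp add: ip_norm_power2 complex_eq_iff)

lemma ip_norm_eq_0: "x \<in> S \<Longrightarrow> ip_norm ip x = 0 \<longleftrightarrow> x = 0"
  using ip_pos[of x] by (cases "x = 0") (auto simp: ip_norm_def)

lemma ip_norm_scale: "x \<in> S \<Longrightarrow> ip_norm ip (smul c x) = cmod c * ip_norm ip x"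
proof -
  assume x: "x \<in> S"
  have "(ip_norm ip (smul c x))\<^sup>2 = Re (c * cnj c * ip x x)"
    using x by (simp only: ip_norm_power2 mem_closed ip_scale_left ip_scale_right mult_ac)
  also have "\<dots> = (cmod c * ip_norm ip x)\<^sup>2"
    using x by (simp add: ip_self power_mult_distrib flip: complex_norm_square of_real_power of_real_mult)
  finally show ?thesis
    using x by (simp add: power2_eq_iff_nonneg)
qed

lemma ip_norm_diff_power2:
  assumes "x \<in> S" "y \<in> S"
  shows "(ip_norm ip (x - y))\<^sup>2 = (ip_norm ip x)\<^sup>2 - 2 * Re (ip x y) + (ip_norm ip y)\<^sup>2"
  using assms ip_commute[of x y] by (simp add: ip_norm_power2 ip_diff_left ip_diff_right)

lemma ip_norm_add_power2:
  assumes "x \<in> S" "y \<in> S"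
  shows "(ip_norm ip (x + y))\<^sup>2 = (ip_norm ip x)\<^sup>2 + 2 * Re (ip x y) + (ip_norm ip y)\<^sup>2"
  using assms ip_commute[of x y] by (simp add: ip_norm_power2 ip_add_left ip_add_right)

lemma Cauchy_Schwarz:
  assumes x: "x \<in> S" and y: "y \<in> S"
  shows "cmod (ip x y) \<le> ip_norm ip x * ip_norm ip y"
proof (cases "y = 0")
  case True
  then show ?thesis using x by simp
next
  case False
  define n where "n = (ip_norm ip y)\<^sup>2"
  have n: "n > 0"
    using False y ip_norm_eq_0 by (simp add: n_def)
  \<comment> \<open>\<open>smul c y\<close> is the projection of \<open>x\<close> onto the line of
    \<open>y\<close>; its squared distance from \<open>x\<close> is nonnegative.\<close>
  define c where "c = ip x y / complex_of_real n"
  have "Re (ip x (smul c y)) = (cmod (ip x y))\<^sup>2 / n"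
    using x y by (simp add: ip_scale_right c_def complex_norm_square[symmetric] mult.commute
        flip: of_real_power of_real_divide)
  moreover have "(ip_norm ip (smul c y))\<^sup>2 = (cmod (ip x y))\<^sup>2 / n"
    using n y by (simp add: ip_norm_scale c_def norm_divide power_mult_distrib power_divide
        flip: n_def) (simp add: power2_eq_square)
  ultimately have "0 \<le> (ip_norm ip x)\<^sup>2 - (cmod (ip x y))\<^sup>2 / n"
    using ip_norm_diff_power2[of x "smul c y"] x y zero_le_power2[of "ip_norm ip (x - smul c y)"]
    by simp
  then have "(cmod (ip x y))\<^sup>2 \<le> (ip_norm ip x * ip_norm ip y)\<^sup>2"
    using n by (simp add: field_simps power_mult_distrib n_def)
  then show ?thesis
    by (rule power2_le_imp_le) (use x y in simp)
qed

lemma ip_norm_triangle: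
  assumes "x \<in> S" "y \<in> S"
  shows "ip_norm ip (x + y) \<le> ip_norm ip x + ip_norm ip y"
proof (rule power2_le_imp_le)
  have "Re (ip x y) \<le> ip_norm ip x * ip_norm ip y"
    using Cauchy_Schwarz[OF assms] complex_Re_le_cmod[of "ip x y"] by linarith
  then show "(ip_norm ip (x + y))\<^sup>2 \<le> (ip_norm ip x + ip_norm ip y)\<^sup>2"
    using assms by (simp add: ip_norm_add_power2 power2_sum)
qed (use assms in simp)

sublocale normed: complex_normed_space smul S "ip_norm ip"
  by unfold_locales
    (use subspace_carrier in \<open>auto simp: ip_norm_eq_0 ip_norm_scale ip_norm_triangle\<close>)

lemma antidual_ip: "x \<in> S \<Longrightarrow> ip x \<in> antidual smul S ip"
  unfolding antidual_def using Cauchy_Schwarz[of x]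
  by (auto simp: ip_add_right ip_scale_right intro!: exI[of _ "ip_norm ip x"])

lemma eq_if_ip_eq:
  assumes "x \<in> S" "y \<in> S" "\<And>v. v \<in> S \<Longrightarrow> ip x v = ip y v"
  shows "x = y"
  using assms(3)[of "x - y"] assms(1,2) ip_norm_eq_0[of "x - y"] ip_self[of "x - y"]
  by (simp add: ip_diff_left)

lemma antidualD:
  assumes "f \<in> antidual smul S ip"
  shows "x \<in> S \<Longrightarrow> y \<in> S \<Longrightarrow> f (x + y) = f x + f y"
    and "x \<in> S \<Longrightarrow> f (smul c x) = cnj c * f x"
    and "f 0 = 0"
  using assms unfolding antidual_def
  apply blast+
  using assms mem_closed(1) scale_zero_left unfolding antidual_def
  by (metis (mono_tags, lifting) complex_cnj_zero mem_Collect_eq mult_zero_left)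

text \<open>The energy \<open>J v = (ip_norm ip v)\<^sup>2 - 2 * Re (f v)\<close> is minimized: by the parallelogram
  law a minimizing sequence is a Cauchy sequence.\<close>

theorem Riesz_representation:
  assumes f: "f \<in> antidual smul S ip"
  shows "\<exists>u\<in>S. \<forall>v\<in>S. ip u v = f v"
proof -
  note fadd = antidualD(1)[OF f] and fscale = antidualD(2)[OF f]
  obtain B0 where B0: "\<And>x. x \<in> S \<Longrightarrow> cmod (f x) \<le> B0 * ip_norm ip x"
    using f unfolding antidual_def by blast
  have B: "Re (f x) \<le> \<bar>B0\<bar> * ip_norm ip x" "- Re (f x) \<le> \<bar>B0\<bar> * ip_norm ip x" if "x \<in> S" for x
  proof -
    have "B0 * ip_norm ip x \<le> \<bar>B0\<bar> * ip_norm ip x"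
      using that by (intro mult_right_mono) auto
    then show "Re (f x) \<le> \<bar>B0\<bar> * ip_norm ip x" "- Re (f x) \<le> \<bar>B0\<bar> * ip_norm ip x"
      using B0[OF that] abs_Re_le_cmod[of "f x"] by linarith+
  qed
  define J where "J v = (ip_norm ip v)\<^sup>2 - 2 * Re (f v)" for v
  have J_lower: "- B0\<^sup>2 \<le> J v" if "v \<in> S" for v
  proof -
    have "0 \<le> (ip_norm ip v - \<bar>B0\<bar>)\<^sup>2" by simp
    also have "\<dots> = (ip_norm ip v)\<^sup>2 - 2 * (\<bar>B0\<bar> * ip_norm ip v) + B0\<^sup>2"
      by (simp add: power2_diff algebra_simps)
    finally show ?thesis using B(1)[OF that] by (simp add: J_def)
  qed
  define d where "d = Inf (J ` S)"
  have bdd: "bdd_below (J ` S)" using J_lower by (auto intro!: bdd_belowI)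
  have d_le: "d \<le> J v" if "v \<in> S" for v
    unfolding d_def using that bdd by (intro cInf_lower) auto
  have "\<exists>v\<in>S. J v < d + 1 / Suc n" for n
  proof -
    have "Inf (J ` S) < d + 1 / Suc n" unfolding d_def by simp
    then show ?thesis using cInf_less_iff[of "J ` S"] bdd mem_closed(1) by blast
  qed
  then obtain X where X: "\<And>n. X n \<in> S" "\<And>n. J (X n) < d + 1 / Suc n"
    by metis
  have parallelogram: "(ip_norm ip (x - y))\<^sup>2 \<le> 2 * (J x - d) + 2 * (J y - d)"
    if "x \<in> S" "y \<in> S" for x y
  proof -
    have "Re (f (smul (1/2) (x + y))) = (Re (f x) + Re (f y)) / 2"
      using that fadd fscale by simp
    moreover have "4 * (ip_norm ip (smul (1/2) (x + y)))\<^sup>2 = (ip_norm ip (x + y))\<^sup>2"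
      using that by (simp add: ip_norm_scale power_mult_distrib norm_divide power_divide)
    ultimately have "4 * J (smul (1/2) (x + y)) = (ip_norm ip (x + y))\<^sup>2 - 4 * Re (f x) - 4 * Re (f y)"
      by (simp add: J_def)
    moreover have "d \<le> J (smul (1/2) (x + y))" using that by (intro d_le) simp
    ultimately show ?thesis
      using ip_norm_diff_power2[OF that] ip_norm_add_power2[OF that] by (simp add: J_def)
  qed
  have "\<exists>x\<in>S. (\<lambda>n. ip_norm ip (X n - x)) \<longlonglongrightarrow> 0"
  proof (rule complete; intro allI impI)
    fix e :: real assume e: "e > 0"
    obtain M where M: "inverse (real (Suc M)) < e\<^sup>2 / 4"
      using reals_Archimedean[of "e\<^sup>2 / 4"] e by auto
    show "\<exists>M. \<forall>m\<ge>M. \<forall>n\<ge>M. ip_norm ip (X m - X n) < e"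
    proof (intro exI[of _ M] allI impI)
      fix m n assume mn: "M \<le> m" "M \<le> n"
      have "1 / real (Suc k) \<le> inverse (real (Suc M))" if "M \<le> k" for k
        using that by (simp add: inverse_eq_divide frac_le)
      from this[OF mn(1)] this[OF mn(2)] have "(ip_norm ip (X m - X n))\<^sup>2 < e\<^sup>2"
        using parallelogram[of "X m" "X n"] X(1)[of m] X(1)[of n] X(2)[of m] X(2)[of n] M by simp
      then show "ip_norm ip (X m - X n) < e"
        by (rule power2_less_imp_less) (use e in simp)
    qed
  qed (rule X(1))
  then obtain u where u: "u \<in> S" "(\<lambda>n. ip_norm ip (X n - u)) \<longlonglongrightarrow> 0" by blast
  have "J u \<le> d"
  proof (rule LIMSEQ_le[of "\<lambda>n. (ip_norm ip (X n))\<^sup>2 - 2 * Re (f u) - 2 * (\<bar>B0\<bar> * ip_norm ip (X n - u))" _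
        "\<lambda>n. d + 1 / Suc n"])
    have "(\<lambda>n. (ip_norm ip (X n))\<^sup>2 - 2 * Re (f u) - 2 * (\<bar>B0\<bar> * ip_norm ip (X n - u)))
        \<longlonglongrightarrow> (ip_norm ip u)\<^sup>2 - 2 * Re (f u) - 2 * (\<bar>B0\<bar> * 0)"
      by (intro tendsto_intros normed.norm_of_limit[OF X(1) u] u)
    then show "(\<lambda>n. (ip_norm ip (X n))\<^sup>2 - 2 * Re (f u) - 2 * (\<bar>B0\<bar> * ip_norm ip (X n - u))) \<longlonglongrightarrow> J u"
      by (simp add: J_def)
    show "(\<lambda>n. d + 1 / real (Suc n)) \<longlonglongrightarrow> d"
      using LIMSEQ_inverse_real_of_nat_add[of d] by (simp add: inverse_eq_divide)
    have "(ip_norm ip (X n))\<^sup>2 - 2 * Re (f u) - 2 * (\<bar>B0\<bar> * ip_norm ip (X n - u)) \<le> d + 1 / real (Suc n)" for n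
    proof -
      have "f (X n) = f (X n - u) + f u"
        using fadd[of "X n - u" u] X(1) u(1) by simp
      then show ?thesis
        using B(1)[of "X n - u"] X(1)[of n] X(2)[of n] u(1) by (simp add: J_def)
    qed
    then show "\<exists>N. \<forall>n\<ge>N. (ip_norm ip (X n))\<^sup>2 - 2 * Re (f u) - 2 * (\<bar>B0\<bar> * ip_norm ip (X n - u)) \<le> d + 1 / real (Suc n)"
      by blast
  qed
  then have min: "J u \<le> J v" if "v \<in> S" for v
    using d_le[OF that] by linarith
  have "ip u v = f v" if v: "v \<in> S" for v
  proof -
    define c where "c = ip u v - f v"
    have "(cmod c)\<^sup>2 \<le> t * (cmod c * ip_norm ip v)\<^sup>2 / 2" if t: "t > 0" for t :: real
    proof -
      \<comment> \<open>The minimizer is perturbed in direction \<open>v\<close>, with the factor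
        \<open>c\<close> chosen so that the first-order term becomes the real number
        \<open>t * (cmod c)\<^sup>2\<close>. The remainder is quadratic in \<open>t\<close>, so
        \<open>t\<close> tending to 0 forces \<open>c = 0\<close>.\<close>
      define y where "y = smul (complex_of_real t * c) v"
      have y: "y \<in> S" using v by (simp add: y_def)
      have "f u = f (u - y) + f y" using fadd[of "u - y" y] u(1) y by simp
      then have "0 \<le> (ip_norm ip y)\<^sup>2 - 2 * Re (ip u y - f y)"
        using min[of "u - y"] ip_norm_diff_power2[OF u(1) y] u(1) y by (simp add: J_def)
      moreover have "ip u y = complex_of_real t * cnj c * ip u v" "f y = complex_of_real t * cnj c * f v"
        using u(1) v fscale by (simp_all add: y_def ip_scale_right)
      then have "ip u y - f y = complex_of_real t * cnj c * ip u v - complex_of_real t * cnj c * f v"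
        by simp
      then have "ip u y - f y = complex_of_real t * (c * cnj c)"
        by (simp only:) (simp add: c_def algebra_simps)
      then have "ip u y - f y = complex_of_real (t * (cmod c)\<^sup>2)"
        by (simp flip: complex_norm_square)
      moreover have "(ip_norm ip y)\<^sup>2 = t * (t * (cmod c * ip_norm ip v)\<^sup>2)"
        using v by (simp add: y_def ip_norm_scale norm_mult power_mult_distrib power2_eq_square)
      ultimately have "t * (2 * (cmod c)\<^sup>2) \<le> t * (t * (cmod c * ip_norm ip v)\<^sup>2)" by simp
      then show ?thesis using t by simp
    qed
    then have "\<forall>\<^sub>F t in at_right 0. (cmod c)\<^sup>2 \<le> t * (cmod c * ip_norm ip v)\<^sup>2 / 2"
      using eventually_at_right_less[of "0::real"] by (rule eventually_mono[rotated])
    moreover have "((\<lambda>t. t * (cmod c * ip_norm ip v)\<^sup>2 / 2) \<longlongrightarrow> 0 * (cmod c * ip_norm ip v)\<^sup>2 / 2) (at_right 0)"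
      by (intro tendsto_intros) auto
    ultimately have "(cmod c)\<^sup>2 \<le> 0"
      using tendsto_lowerbound trivial_limit_at_right_real by fastforce
    then show ?thesis by (simp add: c_def)
  qed
  with u(1) show ?thesis by blast
qed

lemma representing_operator:
  assumes b: "sesquilinear_on smul S b" and cont: "continuous_form S ip M b"
  obtains B where "\<And>u. u \<in> S \<Longrightarrow> B u \<in> S" and "\<And>u v. u \<in> S \<Longrightarrow> v \<in> S \<Longrightarrow> ip (B u) v = b u v"
proof -
  have "\<exists>w\<in>S. \<forall>v\<in>S. ip w v = b u v" if "u \<in> S" for u
  proof (rule Riesz_representation)
    show "b u \<in> antidual smul S ip"
      unfolding antidual_def using that b cont
      by (auto simp: sesquilinear_on_def continuous_form_def intro!: exI[of _ "M * ip_norm ip u"])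
  qed
  then show ?thesis using that by metis
qed

text \<open>If \<open>B\<close> represents \<open>b\<close>, then \<open>ip (B u) (B v)\<close> is an equivalent inner product.  The Riesz
  theorem for it produces \<open>u\<close> such that \<open>B u - F\<close> is orthogonal to the range of \<open>B\<close>, so that
  coercivity forces \<open>B u = F\<close>.\<close>

theorem Lax_Milgram:
  assumes b: "sesquilinear_on smul S b" and cont: "continuous_form S ip M b"
    and alpha: "\<alpha> > 0" and coercive: "\<And>v. v \<in> S \<Longrightarrow> \<alpha> * (ip_norm ip v)\<^sup>2 \<le> Re (b v v)"
    and f: "f \<in> antidual smul S ip"
  shows "\<exists>u\<in>S. \<forall>v\<in>S. b u v = f v"
proof -
  obtain B where B: "\<And>u. u \<in> S \<Longrightarrow> B u \<in> S" "\<And>u v. u \<in> S \<Longrightarrow> v \<in> S \<Longrightarrow> ip (B u) v = b u v"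
    using representing_operator[OF b cont] by blast
  obtain F where F: "F \<in> S" "\<And>v. v \<in> S \<Longrightarrow> ip F v = f v"
    using Riesz_representation[OF f] by blast
  have Badd: "B (x + y) = B x + B y" if "x \<in> S" "y \<in> S" for x y
    using that by (intro eq_if_ip_eq) (simp_all add: B ip_add_left sesquilinear_onD(1)[OF b])
  have Bscale: "B (smul c x) = smul c (B x)" if "x \<in> S" for c x
    using that by (intro eq_if_ip_eq) (simp_all add: B ip_scale_left sesquilinear_onD(3)[OF b])
  have Bdiff: "B (x - y) = B x - B y" if "x \<in> S" "y \<in> S" for x y
    using Badd[of "x - y" y] that by simp
  have lower: "\<alpha> * ip_norm ip v \<le> ip_norm ip (B v)" if v: "v \<in> S" for v
  proof -
    have "\<alpha> * (ip_norm ip v)\<^sup>2 \<le> cmod (ip (B v) v)"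
      using coercive[OF v] complex_Re_le_cmod[of "b v v"] B(2)[OF v v] by simp
    also have "\<dots> \<le> ip_norm ip (B v) * ip_norm ip v"
      using v B by (intro Cauchy_Schwarz) auto
    finally have "(\<alpha> * ip_norm ip v) * ip_norm ip v \<le> ip_norm ip (B v) * ip_norm ip v"
      by (simp add: power2_eq_square)
    then show ?thesis
      by (rule cancel_nonneg_factor) (use v B(1)[OF v] in auto)
  qed
  \<comment> \<open>\<open>continuous_form\<close> leaves the sign of \<open>M\<close> open, while
    the estimates below multiply by a nonnegative constant.\<close>
  define M' where "M' = \<bar>M\<bar>"
  have upper: "ip_norm ip (B v) \<le> M' * ip_norm ip v" if v: "v \<in> S" for v
  proof -
    have "(ip_norm ip (B v))\<^sup>2 \<le> cmod (b v (B v))"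
      using B(2)[OF v B(1)[OF v]] ip_norm_power2[OF B(1)[OF v]] complex_Re_le_cmod[of "b v (B v)"] by simp
    also have "\<dots> \<le> M * ip_norm ip v * ip_norm ip (B v)"
      using cont v B(1)[OF v] by (simp add: continuous_form_def)
    also have "\<dots> \<le> M' * ip_norm ip v * ip_norm ip (B v)"
      using v B(1)[OF v] by (intro mult_right_mono) (auto simp: M'_def)
    finally have "ip_norm ip (B v) * ip_norm ip (B v) \<le> (M' * ip_norm ip v) * ip_norm ip (B v)"
      by (simp add: power2_eq_square)
    then show ?thesis
      by (rule cancel_nonneg_factor) (use v B(1)[OF v] in \<open>auto simp: M'_def\<close>)
  qed
  define c where "c u v = ip (B u) (B v)" for u v
  have c_norm: "ip_norm c v = ip_norm ip (B v)" for v
    by (simp add: ip_norm_def c_def)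
  interpret c: complex_hilbert_space smul S c
  proof (unfold_locales, goal_cases)
    case 1 show ?case by (rule subspace_carrier)
  next
    case (2 x y z) then show ?case by (simp add: c_def Badd B ip_add_left)
  next
    case (3 k x y) then show ?case by (simp add: c_def Bscale B ip_scale_left)
  next
    case (4 x y) then show ?case using ip_commute[of "B x" "B y"] B by (simp add: c_def)
  next
    case (5 x)
    then have "0 < \<alpha> * ip_norm ip x"
      using alpha ip_norm_eq_0[of x] ip_norm_nonneg[of x] by (simp add: less_le)
    then have "0 < (ip_norm ip (B x))\<^sup>2" using lower[OF 5(1)] by simp
    then show ?case using 5 B by (simp add: c_def ip_norm_power2)
  next
    \<comment> \<open>The lower bound for \<open>B\<close> turns a Cauchy sequence for
      \<open>c\<close> into one for \<open>ip\<close>; the upper bound turns the limit back.\<close>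
    case (6 X)
    have "\<exists>x\<in>S. (\<lambda>n. ip_norm ip (X n - x)) \<longlonglongrightarrow> 0"
    proof (rule complete[rule_format]; (intro allI impI)?)
      show "X n \<in> S" for n using 6 by blast
      fix e :: real assume "e > 0"
      then have "\<alpha> * e > 0" using alpha by simp
      then obtain K where "\<forall>m\<ge>K. \<forall>n\<ge>K. ip_norm c (X m - X n) < \<alpha> * e" using 6(2) by blast
      then have "\<forall>m\<ge>K. \<forall>n\<ge>K. \<alpha> * ip_norm ip (X m - X n) < \<alpha> * e"
        using lower 6(1) by (metis c_norm mem_closed(3) order_le_less_trans)
      then show "\<exists>K. \<forall>m\<ge>K. \<forall>n\<ge>K. ip_norm ip (X m - X n) < e" using alpha by auto
    qed
    then obtain x where x: "x \<in> S" "(\<lambda>n. ip_norm ip (X n - x)) \<longlonglongrightarrow> 0" by blast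
    have "(\<lambda>n. ip_norm c (X n - x)) \<longlonglongrightarrow> 0"
    proof (rule Lim_null_comparison)
      show "(\<lambda>n. M' * ip_norm ip (X n - x)) \<longlonglongrightarrow> 0"
        using tendsto_mult[OF tendsto_const x(2), of M'] by simp
      show "\<forall>\<^sub>F n in sequentially. norm (ip_norm c (X n - x)) \<le> M' * ip_norm ip (X n - x)"
        using 6(1) x(1) upper B(1) by (auto simp: c_norm)
    qed
    with x(1) show ?case by blast
  qed
  have "(\<lambda>v. ip F (B v)) \<in> antidual smul S c"
    unfolding antidual_def
    using F(1) B(1) Cauchy_Schwarz[OF F(1) B(1)]
    by (auto simp: Badd Bscale ip_add_right ip_scale_right c_norm intro!: exI[of _ "ip_norm ip F"])
  then obtain u where u: "u \<in> S" "\<And>v. v \<in> S \<Longrightarrow> c u v = ip F (B v)"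
    using c.Riesz_representation by blast
  define r where "r = B u - F"
  have r: "r \<in> S" using u(1) F(1) B(1) by (simp add: r_def)
  have "ip r (B r) = 0"
    using u(2)[OF r] u(1) F(1) B(1) r by (simp add: r_def c_def ip_diff_left)
  then have "Re (b r r) = 0"
    using B(2)[OF r r] ip_commute[of r "B r"] r B(1)[OF r] by simp
  then have "\<alpha> * (ip_norm ip r)\<^sup>2 \<le> 0" using coercive[OF r] by simp
  then have "r = 0" using alpha ip_norm_eq_0[OF r] by (simp add: mult_le_0_iff)
  then have "B u = F" by (simp add: r_def)
  then have "\<forall>v\<in>S. b u v = f v" using B(2) F(2) u(1) by metis
  with u(1) show ?thesis by blast
qed

end

section \<open>Finite-dimensional subspaces and orthogonal projection\<close>

context complex_hilbert_space
begin

lemma span_subset_carrier: "B \<subseteq> S \<Longrightarrow> span B \<subseteq> S"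
  using subspace_carrier by (rule span_minimal[rotated])

text \<open>Gram-Schmidt by induction on the spanning set: the part \<open>q\<close> of the new
  vector that is orthogonal to the old span carries the missing component of \<open>f\<close>. This
  bypasses completeness of the span.\<close>

lemma Riesz_representation_span:
  assumes "finite B" "B \<subseteq> S"
    and "\<And>x y. x \<in> span B \<Longrightarrow> y \<in> span B \<Longrightarrow> f (x + y) = f x + f y"
    and "\<And>c x. x \<in> span B \<Longrightarrow> f (smul c x) = cnj c * f x"
  shows "\<exists>u\<in>span B. \<forall>v\<in>span B. ip u v = f v"
  using assms
proof (induction B arbitrary: f rule: finite_induct)
  case empty
  have "f 0 = 0" using empty(3)[of 0 0] by simp
  then show ?case by simp
next
  case (insert b B)
  have sub: "span B \<subseteq> span (insert b B)" by (intro span_mono) auto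
  have B: "B \<subseteq> S" and b: "b \<in> S" using insert.prems by auto
  have S: "x \<in> S" if "x \<in> span B" for x using span_subset_carrier[OF B] that by blast
  obtain u0 where u0: "u0 \<in> span B" "\<And>v. v \<in> span B \<Longrightarrow> ip u0 v = f v"
    using insert.IH[of f] B insert.prems(2,3) sub by blast
  obtain p where p: "p \<in> span B" "\<And>v. v \<in> span B \<Longrightarrow> ip p v = ip b v"
    using insert.IH[of "ip b"] B b S by (auto simp: ip_add_right ip_scale_right)
  define q where "q = b - p"
  have q: "q \<in> S" "q \<in> span (insert b B)"
    using b p(1) S sub by (auto simp: q_def intro!: span_diff span_base[of b])
  have orth: "ip q v = 0" "ip v q = 0" if "v \<in> span B" for v
  proof -
    show "ip q v = 0" using p that b S by (simp add: q_def ip_diff_left)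
    then show "ip v q = 0" using ip_commute[of q v] q S that by simp
  qed
  \<comment> \<open>If the new vector already lies in the old span, then \<open>q = 0\<close> and
    division by zero yields \<open>c = 0\<close>, which is consistent because
    \<open>f 0 = 0\<close>.\<close>
  define c where "c = f q / complex_of_real ((ip_norm ip q)\<^sup>2)"
  have c: "c * ip q q = f q"
  proof (cases "q = 0")
    case True
    have "f 0 = 0" using insert.prems(3)[of 0 0] span_zero by simp
    with True show ?thesis by simp
  next
    case False
    then show ?thesis using q by (simp add: c_def ip_self ip_norm_eq_0)
  qed
  show ?case
  proof (intro bexI[of _ "u0 + smul c q"] ballI)
    show "u0 + smul c q \<in> span (insert b B)"
      using u0(1) sub q by (auto intro!: span_add span_scale)
    fix v assume "v \<in> span (insert b B)"
    then obtain k where k: "v - smul k b \<in> span B" by (auto simp: span_breakdown_eq)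
    define v0 where "v0 = v - smul k q"
    have "v0 = (v - smul k b) + smul k p"
      by (simp add: v0_def q_def scale_right_diff_distrib)
    then have v0: "v0 \<in> span B" using k p(1) by (simp add: span_add span_scale)
    have "f v = f v0 + f (smul k q)"
      using insert.prems(2)[of v0 "smul k q"] v0 sub q by (auto simp: v0_def intro: span_scale)
    also have "f (smul k q) = cnj k * f q" using insert.prems(3) q by blast
    finally have "f v = f v0 + cnj k * f q" .
    moreover have "ip (u0 + smul c q) (v0 + smul k q) = f v0 + cnj k * f q"
      using u0 v0 S q orth c
      by (simp add: ip_add_left ip_add_right ip_scale_left ip_scale_right)
    ultimately show "ip (u0 + smul c q) v = f v" by (simp add: v0_def)
  qed
qed

text \<open>A dimension count. As \<open>M\<close> is linear only on the span, it is replaced by the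
  globally linear \<open>L\<close> that agrees with it on a basis \<open>C\<close>. The images of
  \<open>C\<close> are independent and as many as \<open>C\<close>, so no vector of the span can lie
  outside their span.\<close>

lemma injective_imp_surjective_span:
  assumes "finite B"
    and add: "\<And>x y. x \<in> span B \<Longrightarrow> y \<in> span B \<Longrightarrow> M (x + y) = M x + M y"
    and scale: "\<And>c x. x \<in> span B \<Longrightarrow> M (smul c x) = smul c (M x)"
    and into: "\<And>x. x \<in> span B \<Longrightarrow> M x \<in> span B"
    and inj: "\<And>x. x \<in> span B \<Longrightarrow> M x = 0 \<Longrightarrow> x = 0"
    and y: "y \<in> span B"
  shows "\<exists>x\<in>span B. M x = y"
proof -
  interpret vp: vector_space_pair smul smul ..
  obtain C where C: "C \<subseteq> B" "independent C" "B \<subseteq> span C"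
    using maximal_independent_subset by blast
  have spanC: "span C = span B"
    using C by (metis span_mono span_span subset_antisym)
  define L where "L = vp.construct C M"
  have lin: "Vector_Spaces.linear smul smul L"
    unfolding L_def by (rule vp.linear_construct[OF C(2)])
  have "x \<in> span B \<and> L x = M x" if "x \<in> span C" for x
    using that
  proof (induction rule: span_induct_alt)
    case base
    show ?case using scale[of 0 0] span_zero vp.linear_0[OF lin] by simp
  next
    case (step c x y)
    then have x: "x \<in> span B" using C(1) by (auto intro: span_base)
    show ?case
      using step vp.construct_basis[OF C(2) step(1), of M, folded L_def] add[of "smul c x" y] scale[of x c] x
      by (simp add: vp.linear_add[OF lin] vp.linear_scale[OF lin] span_scale span_add)
  qed
  then have LM: "L x = M x" if "x \<in> span C" for x
    using that by blast
  have "inj_on L (span C)"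
  proof (rule inj_onI)
    fix x z assume *: "x \<in> span C" "z \<in> span C" "L x = L z"
    then have "M (x - z) = 0"
      using LM[of "x - z"] vp.linear_diff[OF lin, of x z] by (simp add: span_diff)
    then show "x = z" using inj[of "x - z"] * spanC by (simp add: span_diff)
  qed
  then have ind: "independent (L ` C)"
    using vp.linear_independent_injective_image[OF lin C(2)] by blast
  have finC: "finite C" using C(1) assms(1) finite_subset by blast
  have card: "card (L ` C) = card C"
    using \<open>inj_on L (span C)\<close> by (intro card_image) (meson inj_on_subset span_superset)
  have LC: "L ` C \<subseteq> span C"
    using LM into spanC span_superset[of C] by fastforce
  have "y \<in> span (L ` C)"
  proof (rule ccontr)
    assume n: "y \<notin> span (L ` C)"
    then have "independent (insert y (L ` C))" using ind by (simp add: independent_insertI)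
    moreover have "insert y (L ` C) \<subseteq> span C" using y spanC LC by auto
    ultimately have "card (insert y (L ` C)) \<le> card C"
      using independent_span_bound[OF finC] by blast
    moreover have "y \<notin> L ` C" using n span_base by blast
    ultimately show False using finC card by simp
  qed
  then have "y \<in> L ` span C" using vp.linear_span_image[OF lin, of C] by simp
  then show ?thesis using LM spanC by auto
qed

text \<open>In finite dimension uniqueness yields existence: nondegeneracy is injectivity of the
  operator \<open>M\<close> that represents \<open>b\<close>. Since no coercivity is involved, the
  lemma serves the Galerkin equations for \<open>a\<close> itself as well as the projection with
  respect to the perturbed form.\<close>

lemma nondegenerate_form_span:
  assumes fin: "finite B" and B: "B \<subseteq> S" and b: "sesquilinear_on smul (span B) b"
    and nondeg: "\<And>u. u \<in> span B \<Longrightarrow> (\<And>v. v \<in> span B \<Longrightarrow> b u v = 0) \<Longrightarrow> u = 0"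
    and f: "\<And>x y. x \<in> span B \<Longrightarrow> y \<in> span B \<Longrightarrow> f (x + y) = f x + f y"
      "\<And>c x. x \<in> span B \<Longrightarrow> f (smul c x) = cnj c * f x"
  shows "\<exists>u\<in>span B. \<forall>v\<in>span B. b u v = f v"
proof -
  note sesq = sesquilinear_onD[OF b]
  have S: "x \<in> S" if "x \<in> span B" for x using span_subset_carrier[OF B] that by blast
  have "\<exists>w\<in>span B. \<forall>v\<in>span B. ip w v = b u v" if "u \<in> span B" for u
    using that by (intro Riesz_representation_span[OF fin B]) (auto simp: sesq)
  then obtain M where M: "\<And>u. u \<in> span B \<Longrightarrow> M u \<in> span B"
    "\<And>u v. u \<in> span B \<Longrightarrow> v \<in> span B \<Longrightarrow> ip (M u) v = b u v"
    by metis
  have eqI: "x = y" if "x \<in> span B" "y \<in> span B" "\<And>v. v \<in> span B \<Longrightarrow> ip x v = ip y v" for x y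
    using that(3)[of "x - y"] that(1,2) S ip_norm_eq_0[of "x - y"] ip_self[of "x - y"]
    by (simp add: ip_diff_left span_diff)
  obtain F where F: "F \<in> span B" "\<And>v. v \<in> span B \<Longrightarrow> ip F v = f v"
    using Riesz_representation_span[OF fin B f] by blast
  have "\<exists>u\<in>span B. M u = F"
  proof (rule injective_imp_surjective_span[OF fin _ _ M(1) _ F(1)])
    show "M (x + y) = M x + M y" if "x \<in> span B" "y \<in> span B" for x y
      using that M S by (intro eqI) (simp_all add: span_add ip_add_left sesq)
    show "M (smul c x) = smul c (M x)" if "x \<in> span B" for c x
      using that M S by (intro eqI) (simp_all add: span_scale ip_scale_left sesq)
    show "x = 0" if "x \<in> span B" "M x = 0" for x
      using M(2)[OF that(1), unfolded that(2)] S by (intro nondeg[OF that(1)]) force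
  qed
  then show ?thesis using M(2) F(2) by metis
qed

text \<open>The projection is the Riesz representative of \<open>ip x\<close> in \<open>V\<close>,
  which justifies the definite description.\<close>

lemma orth_proj:
  assumes V: "V = span B" "finite B" "B \<subseteq> S" and x: "x \<in> S"
  shows "orth_proj ip V x \<in> V"
    and "w \<in> V \<Longrightarrow> ip (x - orth_proj ip V x) w = 0"
    and "p \<in> V \<Longrightarrow> (\<And>w. w \<in> V \<Longrightarrow> ip (x - p) w = 0) \<Longrightarrow> orth_proj ip V x = p"
proof -
  have S: "x \<in> S" if "x \<in> V" for x using span_subset_carrier V that by blast
  have unique: "p = q"
    if "p \<in> V" "q \<in> V" "\<And>w. w \<in> V \<Longrightarrow> ip (x - p) w = 0" "\<And>w. w \<in> V \<Longrightarrow> ip (x - q) w = 0" for p q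
  proof -
    have pq: "p - q \<in> V" using that V by (simp add: span_diff)
    have "ip (p - q) (p - q) = ip (x - q) (p - q) - ip (x - p) (p - q)"
      using that S pq x ip_diff_left[of "x - q" "x - p" "p - q"] by simp
    then show ?thesis using that(3,4)[OF pq] ip_pos[of "p - q"] S[OF pq] by force
  qed
  obtain p where p: "p \<in> V" "\<And>v. v \<in> V \<Longrightarrow> ip p v = ip x v"
    using Riesz_representation_span[OF V(2,3), of "ip x"] x S V(1)
    by (auto simp: ip_add_right ip_scale_right)
  have "ip (x - p) v = 0" if "v \<in> V" for v
    using p that x S by (simp add: ip_diff_left)
  with p(1) have ex1: "\<exists>!p. p \<in> V \<and> (\<forall>w\<in>V. ip (x - p) w = 0)"
    using unique by blast
  from theI'[OF ex1] show "orth_proj ip V x \<in> V" "w \<in> V \<Longrightarrow> ip (x - orth_proj ip V x) w = 0"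
    by (auto simp: orth_proj_def)
  show "orth_proj ip V x = p" if "p \<in> V" "\<And>w. w \<in> V \<Longrightarrow> ip (x - p) w = 0" for p
    unfolding orth_proj_def by (rule the1_equality[OF ex1]) (use that in blast)
qed

lemma proj_error:
  assumes V: "V = span B" "finite B" "B \<subseteq> S" and x: "x \<in> S"
  shows "proj_error ip V x \<in> S"
    and "proj_error ip V (smul c x) = smul c (proj_error ip V x)"
    and "ip_norm ip (proj_error ip V x) \<le> ip_norm ip x"
proof -
  note P = orth_proj[OF V]
  have S: "x \<in> S" if "x \<in> V" for x using span_subset_carrier V that by blast
  show e: "proj_error ip V x \<in> S"
    using P(1)[OF x] S x by (simp add: proj_error_def)
  have "orth_proj ip V (smul c x) = smul c (orth_proj ip V x)"
  proof (rule P(3))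
    show "smul c (orth_proj ip V x) \<in> V" using P(1)[OF x] V(1) by (simp add: span_scale)
    show "ip (smul c x - smul c (orth_proj ip V x)) w = 0" if "w \<in> V" for w
      using that P(1,2)[OF x] S x
      by (simp add: ip_scale_left flip: scale_right_diff_distrib)
  qed (use x in simp)
  then show "proj_error ip V (smul c x) = smul c (proj_error ip V x)"
    by (simp add: proj_error_def scale_right_diff_distrib)
  have "(ip_norm ip x)\<^sup>2 = (ip_norm ip (proj_error ip V x))\<^sup>2 + (ip_norm ip (orth_proj ip V x))\<^sup>2"
    using ip_norm_add_power2[of "proj_error ip V x" "orth_proj ip V x"] e P(1,2)[OF x] S
    by (simp add: proj_error_def)
  then have "(ip_norm ip (proj_error ip V x))\<^sup>2 \<le> (ip_norm ip x)\<^sup>2" by simp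
  then show "ip_norm ip (proj_error ip V x) \<le> ip_norm ip x"
    by (rule power2_le_imp_le) (use x in simp)
qed

end

text \<open>The components at \<open>j\<close> bound the powers of the resolvent from \<open>H0\<close> to \<open>Z j\<close> and to
  \<open>Z (Suc j)\<close>: elliptic regularity gains two orders at a time.\<close>

primrec regularity_const :: "real \<Rightarrow> real \<Rightarrow> real \<Rightarrow> nat \<Rightarrow> real \<times> real" where
  "regularity_const CG1 CG2 Cell 0 = (1, 1 / sqrt CG1)"
| "regularity_const CG1 CG2 Cell (Suc j) =
    (snd (regularity_const CG1 CG2 Cell j),
     Cell * (1 + (CG2 + 2) * fst (regularity_const CG1 CG2 Cell j)))"

text \<open>The base \<open>c = 2 ^ l * (CG2 + 1) / 2\<close> makes the energy term of the interpolation estimate for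
  \<open>(CG2 + 1) * (n0 x)\<^sup>2\<close> equal to half of the energy.\<close>

definition smoothing_const :: "real \<Rightarrow> nat \<Rightarrow> real" where
  "smoothing_const CG2 l = (CG2 + 1) * (2 ^ l * (CG2 + 1) / 2) ^ (2 ^ l)"

text \<open>The second summand bounds the smoothing term, each of whose arguments passes once
  through the inclusion of \<open>H\<close> in \<open>H0\<close>.\<close>

definition modified_cont_const :: "real \<Rightarrow> real \<Rightarrow> real \<Rightarrow> nat \<Rightarrow> real" where
  "modified_cont_const Ccont CG2 Cemb l = Ccont + smoothing_const CG2 l * Cemb\<^sup>2"

text \<open>The solution \<open>w\<close> of the smoothed dual problem satisfies
  \<open>n0 w \<le> 2 * K * n0 e\<close>, the first summand; the second bounds the
  \<open>Z (l - 1)\<close> norm of \<open>smoothing (e - w)\<close>, where \<open>1 + 2 * K\<close>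
  comes from \<open>n0 (e - w)\<close>.\<close>

definition dual_regularity_const :: "real \<Rightarrow> real \<Rightarrow> real \<Rightarrow> nat \<Rightarrow> real" where
  "dual_regularity_const CG1 CG2 Cell l =
    (let K = smoothing_const CG2 l in
      Cell * (2 * K + K * fst (regularity_const CG1 CG2 Cell (l - 1)) * (1 + 2 * K)))"

section \<open>The energy form and its solution operator\<close>

locale galerkin_analysis = galerkin_setting +
  assumes Ccont_pos: "Ccont > 0" and CG1_pos: "CG1 > 0" and CG2_pos: "CG2 > 0"
    and Cell_pos: "Cell > 0" and Cemb_pos: "Cemb > 0" and l_pos: "l \<ge> 1"
begin

abbreviation "n0 \<equiv> ip_norm ip0"
abbreviation "nH \<equiv> ip_norm ipH"

lemma H_subset [simp]: "x \<in> H \<Longrightarrow> x \<in> H0"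
  using inclusion by blast

lemmas a_add_left = sesquilinear_onD(1)[OF sesquilinear]
  and a_add_right = sesquilinear_onD(2)[OF sesquilinear]
  and a_scale_left = sesquilinear_onD(3)[OF sesquilinear]
  and a_scale_right = sesquilinear_onD(4)[OF sesquilinear]
  and a_diff_left = sesquilinear_on_diff(1)[OF sesquilinear sp0.vector_space_axioms sp1.subspace_carrier]
  and a_diff_right = sesquilinear_on_diff(2)[OF sesquilinear sp0.vector_space_axioms sp1.subspace_carrier]
  and a_zero = sesquilinear_on_zero[OF sesquilinear sp0.vector_space_axioms sp1.subspace_carrier]

lemma a_bound: "u \<in> H \<Longrightarrow> v \<in> H \<Longrightarrow> cmod (a u v) \<le> Ccont * nH u * nH v"
  using continuous by (simp add: continuous_form_def)

lemma n0_mult_bound: "u \<in> H \<Longrightarrow> v \<in> H \<Longrightarrow> n0 u * n0 v \<le> Cemb\<^sup>2 * nH u * nH v"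
  using mult_mono[OF inclusion_bound[of u] inclusion_bound[of v]] Cemb_pos
  by (simp add: power2_eq_square mult_ac)

lemma ip0_bound:
  assumes "x \<in> H0" "v \<in> H" shows "cmod (ip0 x v) \<le> n0 x * Cemb * nH v"
proof -
  have "cmod (ip0 x v) \<le> n0 x * n0 v" using assms by (intro sp0.Cauchy_Schwarz) auto
  also have "\<dots> \<le> n0 x * (Cemb * nH v)"
    using assms inclusion_bound by (intro mult_left_mono) auto
  finally show ?thesis by simp
qed

lemma antidual_ip0: "x \<in> H0 \<Longrightarrow> ip0 x \<in> antidual smul H ipH"
  unfolding antidual_def using ip0_bound[of x]
  by (auto simp: sp0.ip_add_right sp0.ip_scale_right intro!: exI[of _ "n0 x * Cemb"])

text \<open>The excess of one over \<open>CG2\<close> leaves a full \<open>(n0 v)\<^sup>2\<close> in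
  the lower bound. Hence \<open>resolvent\<close> is a contraction of \<open>H0\<close>, and its
  powers need no constants that grow with the exponent.\<close>

definition energy :: "'a \<Rightarrow> 'a \<Rightarrow> complex" where
  "energy u v = re_form a u v + complex_of_real (CG2 + 1) * ip0 u v"

lemma sesquilinear_energy: "sesquilinear_on smul H energy"
  by (rule sesquilinear_onI)
    (simp_all add: energy_def re_form_def a_add_left a_add_right a_scale_left a_scale_right
      sp0.ip_add_left sp0.ip_add_right sp0.ip_scale_left sp0.ip_scale_right add_divide_distrib algebra_simps)

lemmas energy_diff_left =
    sesquilinear_on_diff(1)[OF sesquilinear_energy sp0.vector_space_axioms sp1.subspace_carrier]
  and energy_diff_right =
    sesquilinear_on_diff(2)[OF sesquilinear_energy sp0.vector_space_axioms sp1.subspace_carrier]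
  and energy_scale_left = sesquilinear_onD(3)[OF sesquilinear_energy]
  and energy_scale_right = sesquilinear_onD(4)[OF sesquilinear_energy]

lemma energy_commute: "u \<in> H \<Longrightarrow> v \<in> H \<Longrightarrow> energy v u = cnj (energy u v)"
  using sp0.ip_commute[of u v] by (simp add: energy_def re_form_def)

lemma Re_energy: "v \<in> H \<Longrightarrow> Re (energy v v) = Re (a v v) + (CG2 + 1) * (n0 v)\<^sup>2"
  by (simp add: energy_def re_form_def sp0.ip_self flip: of_real_power)

lemma energy_lower: "v \<in> H \<Longrightarrow> CG1 * (nH v)\<^sup>2 + (n0 v)\<^sup>2 \<le> Re (energy v v)"
  using garding_ineq by (auto simp: Re_energy garding_def algebra_simps)

lemma energy_nonneg: "v \<in> H \<Longrightarrow> 0 \<le> Re (energy v v)"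
  using energy_lower[of v] CG1_pos by (smt (verit) mult_nonneg_nonneg zero_le_power2)

lemma continuous_energy: "continuous_form H ipH (Ccont + (CG2 + 1) * Cemb\<^sup>2) energy"
  unfolding continuous_form_def
proof (intro ballI)
  fix u v assume u: "u \<in> H" and v: "v \<in> H"
  have "cmod (re_form a u v) \<le> (cmod (a u v) + cmod (a v u)) / 2"
    unfolding re_form_def using norm_triangle_ineq[of "a u v" "cnj (a v u)"]
    by (simp add: norm_divide)
  then have "cmod (re_form a u v) \<le> Ccont * nH u * nH v"
    using a_bound[OF u v] a_bound[OF v u] by (simp add: mult_ac)
  moreover have "cmod (complex_of_real (CG2 + 1) * ip0 u v) \<le> (CG2 + 1) * (Cemb\<^sup>2 * nH u * nH v)"
    using sp0.Cauchy_Schwarz[of u v] n0_mult_bound[OF u v] u v CG2_pos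
    by (auto simp del: of_real_add simp: norm_mult intro!: mult_left_mono)
  ultimately show "cmod (energy u v) \<le> (Ccont + (CG2 + 1) * Cemb\<^sup>2) * nH u * nH v"
    unfolding energy_def using norm_triangle_ineq[of "re_form a u v" "complex_of_real (CG2 + 1) * ip0 u v"]
    by (simp add: algebra_simps)
qed

text \<open>In operator terms this is the inverse of \<open>A + (CG2 + 1)\<close>, with
  \<open>A\<close> the self-adjoint operator of \<open>re_form a\<close>. On \<open>H0\<close> the
  choice is canonical by \<open>resolvent_unique\<close>.\<close>

definition resolvent :: "'a \<Rightarrow> 'a" where
  "resolvent x = (SOME z. z \<in> H \<and> (\<forall>v\<in>H. energy z v = ip0 x v))"

lemma resolvent:
  assumes "x \<in> H0"
  shows resolvent_in [simp]: "resolvent x \<in> H"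
    and energy_resolvent: "v \<in> H \<Longrightarrow> energy (resolvent x) v = ip0 x v"
proof -
  have "\<exists>z\<in>H. \<forall>v\<in>H. energy z v = ip0 x v"
  proof (rule sp1.Lax_Milgram[OF sesquilinear_energy continuous_energy CG1_pos _ antidual_ip0[OF assms]])
    show "CG1 * (nH v)\<^sup>2 \<le> Re (energy v v)" if "v \<in> H" for v
      using energy_lower[OF that] zero_le_power2[of "n0 v"] by linarith
  qed
  then have "resolvent x \<in> H \<and> (\<forall>v\<in>H. energy (resolvent x) v = ip0 x v)"
    unfolding resolvent_def by (rule_tac someI_ex) blast
  then show "resolvent x \<in> H" "v \<in> H \<Longrightarrow> energy (resolvent x) v = ip0 x v" by auto
qed

lemma resolvent_unique:
  assumes "x \<in> H0" "z \<in> H" "\<And>v. v \<in> H \<Longrightarrow> energy z v = ip0 x v"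
  shows "resolvent x = z"
proof -
  define d where "d = resolvent x - z"
  have d: "d \<in> H" using assms by (simp add: d_def)
  have "energy d d = 0"
    using assms d energy_resolvent by (simp add: energy_diff_left d_def)
  then have "CG1 * (nH d)\<^sup>2 + (n0 d)\<^sup>2 \<le> 0" using energy_lower[OF d] by simp
  moreover have "0 \<le> CG1 * (nH d)\<^sup>2" using CG1_pos by simp
  ultimately have "(n0 d)\<^sup>2 = 0" using zero_le_power2[of "n0 d"] by linarith
  then have "d = 0" using d by (simp add: sp0.ip_norm_eq_0)
  then show ?thesis by (simp add: d_def)
qed

lemma resolvent_diff: "x \<in> H0 \<Longrightarrow> y \<in> H0 \<Longrightarrow> resolvent (x - y) = resolvent x - resolvent y"
  by (rule resolvent_unique) (simp_all add: energy_diff_left energy_resolvent sp0.ip_diff_left)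

lemma resolvent_scale: "x \<in> H0 \<Longrightarrow> resolvent (smul c x) = smul c (resolvent x)"
  by (rule resolvent_unique) (simp_all add: energy_scale_left energy_resolvent sp0.ip_scale_left)

lemma resolvent_add: "x \<in> H0 \<Longrightarrow> y \<in> H0 \<Longrightarrow> resolvent (x + y) = resolvent x + resolvent y"
  using resolvent_diff[of "x + y" y] by simp

text \<open>Both sides equal \<open>energy (resolvent x) (resolvent y)\<close>, as the energy is
  hermitian.\<close>

lemma resolvent_symmetric:
  assumes "x \<in> H0" "y \<in> H0" shows "ip0 (resolvent x) y = ip0 x (resolvent y)"
  using assms sp0.ip_commute[of y "resolvent x"] energy_commute[of "resolvent y" "resolvent x"]
    energy_resolvent[of y "resolvent x"] energy_resolvent[of x "resolvent y"]
  by simp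

text \<open>The defining identity is tested with \<open>resolvent x\<close> itself.\<close>

lemma resolvent_bounds:
  assumes x: "x \<in> H0"
  shows resolvent_contraction: "n0 (resolvent x) \<le> n0 x"
    and resolvent_H_bound: "nH (resolvent x) \<le> n0 x / sqrt CG1"
proof -
  let ?z = "resolvent x"
  have z: "?z \<in> H" using x by simp
  have "Re (energy ?z ?z) \<le> cmod (ip0 x ?z)"
    using energy_resolvent[OF x z] complex_Re_le_cmod by simp
  also have "\<dots> \<le> n0 x * n0 ?z" using x z by (intro sp0.Cauchy_Schwarz) auto
  finally have *: "CG1 * (nH ?z)\<^sup>2 + (n0 ?z)\<^sup>2 \<le> n0 x * n0 ?z"
    using energy_lower[OF z] by linarith
  have "0 \<le> CG1 * (nH ?z)\<^sup>2" using CG1_pos by simp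
  with * have "n0 ?z * n0 ?z \<le> n0 x * n0 ?z" by (simp add: power2_eq_square)
  then show le: "n0 ?z \<le> n0 x"
    by (rule cancel_nonneg_factor) (use x z in auto)
  have "n0 x * n0 ?z \<le> n0 x * n0 x" using le x by (intro mult_left_mono) auto
  then have "CG1 * (nH ?z)\<^sup>2 \<le> (n0 x)\<^sup>2"
    using * zero_le_power2[of "n0 ?z"] unfolding power2_eq_square by linarith
  then have "(sqrt CG1 * nH ?z)\<^sup>2 \<le> (n0 x)\<^sup>2"
    using CG1_pos by (simp add: power_mult_distrib)
  then have "sqrt CG1 * nH ?z \<le> n0 x"
    by (rule power2_le_imp_le) (use x in simp)
  then show "nH ?z \<le> n0 x / sqrt CG1" using CG1_pos by (simp add: field_simps)
qed

section \<open>Powers of the resolvent and their moments\<close>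

abbreviation resolvent_pow :: "nat \<Rightarrow> 'a \<Rightarrow> 'a" where
  "resolvent_pow m \<equiv> resolvent ^^ m"

lemma resolvent_pow_in [simp]: "x \<in> H0 \<Longrightarrow> resolvent_pow m x \<in> H0"
  by (induction m) auto

lemma resolvent_pow_linear:
  assumes "x \<in> H0" "y \<in> H0"
  shows "resolvent_pow m (x + y) = resolvent_pow m x + resolvent_pow m y"
    and "resolvent_pow m (x - y) = resolvent_pow m x - resolvent_pow m y"
  using assms by (induction m) (auto simp: resolvent_add resolvent_diff)

lemma resolvent_pow_scale:
  "x \<in> H0 \<Longrightarrow> resolvent_pow m (smul c x) = smul c (resolvent_pow m x)"
  by (induction m) (auto simp: resolvent_scale)

lemma resolvent_pow_contraction: "x \<in> H0 \<Longrightarrow> n0 (resolvent_pow m x) \<le> n0 x"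
proof (induction m)
  case (Suc m)
  then show ?case using resolvent_contraction[of "resolvent_pow m x"] by simp
qed simp

text \<open>These are the moments of the spectral measure of \<open>resolvent\<close> at
  \<open>x\<close>; phrased this way, the interpolation argument stays clear of the spectral
  theorem.\<close>

definition moment :: "nat \<Rightarrow> 'a \<Rightarrow> real" where
  "moment m x = Re (ip0 (resolvent_pow m x) x)"

lemma moment_0: "x \<in> H0 \<Longrightarrow> moment 0 x = (n0 x)\<^sup>2"
  by (simp add: moment_def sp0.ip_norm_power2)

lemma moment_1: "x \<in> H0 \<Longrightarrow> moment 1 x = Re (energy (resolvent x) (resolvent x))"
  by (simp add: moment_def energy_resolvent resolvent_symmetric)

lemma moment_add_2: "x \<in> H0 \<Longrightarrow> moment (Suc (Suc m)) x = moment m (resolvent x)"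
proof -
  assume x: "x \<in> H0"
  have eq: "resolvent_pow (Suc (Suc m)) x = resolvent (resolvent_pow m (resolvent x))"
    by (simp add: funpow_swap1)
  show ?thesis
    unfolding moment_def eq using x by (simp add: resolvent_symmetric)
qed

text \<open>Moving one resolvent to the other argument lowers the order by two, so even moments
  reduce to a squared norm and odd ones to an energy.\<close>

lemma moment_nonneg: "x \<in> H0 \<Longrightarrow> 0 \<le> moment m x"
proof (induction m arbitrary: x rule: induct_nat_012)
  case 1 then show ?case using moment_1[of x] energy_nonneg[of "resolvent x"] by simp
qed (simp_all add: moment_0 moment_add_2)

lemma moment_le: "x \<in> H0 \<Longrightarrow> moment m x \<le> (n0 x)\<^sup>2"
proof -
  assume x: "x \<in> H0"
  have "moment m x \<le> n0 (resolvent_pow m x) * n0 x"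
    unfolding moment_def
    using sp0.Cauchy_Schwarz[of "resolvent_pow m x" x] complex_Re_le_cmod[of "ip0 (resolvent_pow m x) x"] x
    by simp
  also have "\<dots> \<le> n0 x * n0 x"
    using resolvent_pow_contraction[OF x] x by (intro mult_right_mono) auto
  finally show ?thesis by (simp add: power2_eq_square)
qed

text \<open>Both estimates below expand the nonnegative quadratic form at \<open>x - t * resolvent x\<close>, which
  gives the log-convexity of the sequence \<open>Re (energy x x), moment 0 x, moment 1 x, \<dots>\<close> in
  additive form.\<close>

lemma moment_interpolation:
  assumes x: "x \<in> H0"
  shows "2 * t * moment (Suc m) x \<le> moment m x + t\<^sup>2 * moment (Suc (Suc m)) x"
proof -
  let ?T = "resolvent_pow m"
  let ?t = "complex_of_real t"
  have "0 \<le> moment m (x - smul ?t (resolvent x))"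
    using x by (intro moment_nonneg) simp
  also have "ip0 (?T (x - smul ?t (resolvent x))) (x - smul ?t (resolvent x)) =
      ip0 (?T x) x - ?t * ip0 (?T (resolvent x)) x - ?t * ip0 (?T x) (resolvent x)
      + ?t * ?t * ip0 (?T (resolvent x)) (resolvent x)"
    using x by (simp add: resolvent_pow_linear resolvent_pow_scale sp0.ip_diff_left sp0.ip_diff_right
        sp0.ip_scale_left sp0.ip_scale_right algebra_simps)
  then have "moment m (x - smul ?t (resolvent x)) =
      moment m x - 2 * t * moment (Suc m) x + t\<^sup>2 * moment (Suc (Suc m)) x"
    using x by (simp add: moment_def resolvent_symmetric[symmetric] power2_eq_square
        flip: funpow_swap1)
  finally show ?thesis by simp
qed

lemma energy_interpolation:
  assumes x: "x \<in> H"
  shows "2 * t * (n0 x)\<^sup>2 \<le> Re (energy x x) + t\<^sup>2 * moment 1 x"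
proof -
  let ?t = "complex_of_real t"
  have "0 \<le> Re (energy (x - smul ?t (resolvent x)) (x - smul ?t (resolvent x)))"
    using x by (intro energy_nonneg) simp
  also have "energy (x - smul ?t (resolvent x)) (x - smul ?t (resolvent x)) =
      energy x x - ?t * energy (resolvent x) x - ?t * energy x (resolvent x)
      + ?t * ?t * energy (resolvent x) (resolvent x)"
    using x by (simp add: energy_diff_left energy_diff_right
        energy_scale_left energy_scale_right algebra_simps)
  also have "Re \<dots> = Re (energy x x) - 2 * t * (n0 x)\<^sup>2 + t\<^sup>2 * moment 1 x"
    using x energy_resolvent[of x x] energy_commute[of "resolvent x" x]
    by (simp add: moment_1[simplified] sp0.ip_norm_power2 power2_eq_square[of t])
  finally show ?thesis by simp
qed

text \<open>Large \<open>c\<close> makes the share of the energy small, at the price of a large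
  multiple of a high moment. In each round the current moment is interpolated with \<open>t\<close>
  equal to its own coefficient; the lower moment is at most \<open>(n0 x)\<^sup>2\<close>, and half
  of it is absorbed on the left. This doubles the coefficient of the energy and squares that of the
  moment.\<close>

lemma moment_lower:
  assumes x: "x \<in> H" and c: "c > 0"
  shows "(n0 x)\<^sup>2 \<le> 2 ^ n / (4 * c) * Re (energy x x) + c ^ (2 ^ n) * moment (Suc n) x"
proof (induction n)
  case 0
  show ?case
    using energy_interpolation[OF x, of "2 * c"] c by (simp add: field_simps power2_eq_square)
next
  case (Suc n)
  let ?C = "c ^ (2 ^ n)"
  have C: "?C > 0" using c by simp
  have "2 * (?C * moment (Suc n) x) \<le> (n0 x)\<^sup>2 + ?C\<^sup>2 * moment (Suc (Suc n)) x"
    using moment_interpolation[of x ?C n] moment_le[of x n] x by simp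
  then have "(n0 x)\<^sup>2 \<le> 2 * (2 ^ n / (4 * c) * Re (energy x x)) + ?C\<^sup>2 * moment (Suc (Suc n)) x"
    using Suc by linarith
  moreover have "?C\<^sup>2 = c ^ (2 ^ Suc n)" by (simp add: power_mult[symmetric] mult.commute)
  moreover have "2 ^ Suc n / (4 * c) * Re (energy x x) = 2 * (2 ^ n / (4 * c) * Re (energy x x))"
    by simp
  ultimately show ?case by (simp only:)
qed

section \<open>The smoothing perturbation and coercivity\<close>

abbreviation "K \<equiv> smoothing_const CG2 l"

lemma K_pos: "K > 0"
  using CG2_pos by (simp add: smoothing_const_def)

text \<open>The exponent is the order of the moment that \<open>moment_lower\<close> reaches after
  \<open>l\<close> rounds. It exceeds \<open>l - 1\<close>, the number of powers that carry
  \<open>H0\<close> into \<open>Z (l - 1)\<close>.\<close>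

definition smoothing :: "'a \<Rightarrow> 'a" where
  "smoothing x = smul (complex_of_real K) (resolvent_pow (Suc l) x)"

definition modified_form :: "'a \<Rightarrow> 'a \<Rightarrow> complex" where
  "modified_form u v = a u v + ip0 (smoothing u) v"

lemma smoothing_in [simp]: "x \<in> H0 \<Longrightarrow> smoothing x \<in> H0"
  unfolding smoothing_def using resolvent_pow_in[of x "Suc l"] by simp

lemma smoothing_linear:
  assumes "x \<in> H0" "y \<in> H0"
  shows "smoothing (x + y) = smoothing x + smoothing y"
    and "smoothing (x - y) = smoothing x - smoothing y"
  unfolding smoothing_def resolvent_pow_linear[OF assms]
  by (simp_all add: sp0.scale_right_distrib sp0.scale_right_diff_distrib)

lemma smoothing_scale: "x \<in> H0 \<Longrightarrow> smoothing (smul c x) = smul c (smoothing x)"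
  unfolding smoothing_def by (simp only: resolvent_pow_scale sp0.scale_scale mult.commute)

lemma smoothing_bound: "x \<in> H0 \<Longrightarrow> n0 (smoothing x) \<le> K * n0 x"
  unfolding smoothing_def using resolvent_pow_contraction[of x "Suc l"] resolvent_pow_in[of x "Suc l"] K_pos
  by (simp add: sp0.ip_norm_scale del: funpow.simps)

lemma sesquilinear_modified: "sesquilinear_on smul H modified_form"
  by (rule sesquilinear_onI)
    (simp_all add: modified_form_def smoothing_linear smoothing_scale a_add_left a_add_right a_scale_left a_scale_right
      sp0.ip_add_left sp0.ip_add_right sp0.ip_scale_left sp0.ip_scale_right algebra_simps)

lemma continuous_modified:
  "continuous_form H ipH (modified_cont_const Ccont CG2 Cemb l) modified_form"
  unfolding continuous_form_def
proof (intro ballI)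
  fix u v assume u: "u \<in> H" and v: "v \<in> H"
  have "cmod (ip0 (smoothing u) v) \<le> n0 (smoothing u) * n0 v"
    using u v by (intro sp0.Cauchy_Schwarz) auto
  also have "\<dots> \<le> K * n0 u * n0 v"
    using u v smoothing_bound by (intro mult_right_mono) auto
  also have "\<dots> \<le> K * (Cemb\<^sup>2 * nH u * nH v)"
    using n0_mult_bound[OF u v] K_pos by (simp add: mult.assoc)
  finally show "cmod (modified_form u v) \<le> modified_cont_const Ccont CG2 Cemb l * nH u * nH v"
    unfolding modified_form_def modified_cont_const_def
    using norm_triangle_ineq[of "a u v" "ip0 (smoothing u) v"] a_bound[OF u v]
    by (simp add: algebra_simps)
qed

lemma modified_coercive_energy:
  assumes v: "v \<in> H"
  shows "Re (energy v v) / 2 \<le> Re (modified_form v v)"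
proof -
  define c where "c = 2 ^ l * (CG2 + 1) / 2"
  have c: "c > 0" using CG2_pos by (simp add: c_def)
  have K: "K = (CG2 + 1) * c ^ (2 ^ l)" by (simp add: smoothing_const_def c_def)
  have "(CG2 + 1) * (n0 v)\<^sup>2
      \<le> (CG2 + 1) * (2 ^ l / (4 * c) * Re (energy v v) + c ^ (2 ^ l) * moment (Suc l) v)"
    using moment_lower[OF v c, of l] CG2_pos by (intro mult_left_mono) auto
  also have "\<dots> = (CG2 + 1) * (2 ^ l / (4 * c)) * Re (energy v v) + K * moment (Suc l) v"
    unfolding K by (simp add: algebra_simps)
  also have "(CG2 + 1) * (2 ^ l / (4 * c)) = 1 / 2"
    unfolding c_def using CG2_pos by (subst nonzero_eq_divide_eq) auto
  finally have "(CG2 + 1) * (n0 v)\<^sup>2 \<le> Re (energy v v) / 2 + K * moment (Suc l) v" by simp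
  moreover have "Re (ip0 (smoothing v) v) = K * moment (Suc l) v"
    using resolvent_pow_in[of v "Suc l"] v
    by (simp add: smoothing_def moment_def sp0.ip_scale_left del: funpow.simps)
  moreover have "Re (modified_form v v) = Re (a v v) + Re (ip0 (smoothing v) v)"
    by (simp add: modified_form_def)
  ultimately show ?thesis using Re_energy[OF v] by linarith
qed

text \<open>The second bound estimates solutions directly in \<open>n0\<close>, which keeps the dual
  regularity constant free of \<open>Cemb\<close>.\<close>

lemma modified_coercive:
  assumes v: "v \<in> H"
  shows "CG1 / 2 * (nH v)\<^sup>2 \<le> Re (modified_form v v)"
    and "(n0 v)\<^sup>2 / 2 \<le> Re (modified_form v v)"
proof -
  have "0 \<le> CG1 * (nH v)\<^sup>2" using CG1_pos by simp
  then show "CG1 / 2 * (nH v)\<^sup>2 \<le> Re (modified_form v v)" "(n0 v)\<^sup>2 / 2 \<le> Re (modified_form v v)"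
    using modified_coercive_energy[OF v] energy_lower[OF v] zero_le_power2[of "n0 v"] by linarith+
qed

end

section \<open>Elliptic regularity\<close>

text \<open>\<open>nZ 0\<close> and \<open>nZ 1\<close> agree with the Hilbert norms only on the
  carriers, so the locale has to be transferred along an equality on the carrier.\<close>

lemma complex_normed_space_cong:
  assumes "complex_normed_space smul S N" "\<And>x. x \<in> S \<Longrightarrow> N' x = N x"
  shows "complex_normed_space smul S N'"
proof -
  interpret complex_normed_space smul S N by (rule assms)
  show ?thesis
    by unfold_locales
      (use subspace_carrier norm_nonneg norm_eq_0 norm_scale norm_triangle in \<open>simp_all add: assms(2)\<close>)
qed

lemma regularity_const_nonneg:
  assumes "CG1 > 0" "CG2 > 0" "Cell > 0"
  shows "0 \<le> fst (regularity_const CG1 CG2 Cell j)"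
proof -
  have "0 \<le> fst (regularity_const CG1 CG2 Cell j) \<and> 0 \<le> snd (regularity_const CG1 CG2 Cell j)"
    using assms by (induction j) auto
  then show ?thesis by simp
qed

context galerkin_analysis
begin

lemma Z_0: "Z 0 = H0" "x \<in> H0 \<Longrightarrow> nZ 0 x = n0 x"
  and Z_1: "Z (Suc 0) = H" "x \<in> H \<Longrightarrow> nZ (Suc 0) x = nH x"
  using regularity unfolding elliptic_regularity_def by simp_all

lemma normed_Z: "j \<le> l + 1 \<Longrightarrow> complex_normed_space smul (Z j) (nZ j)"
proof -
  assume j: "j \<le> l + 1"
  consider "j = 0" | "j = 1" | "j \<in> {2..l + 1}" using j by fastforce
  then show ?thesis
  proof cases
    case 1
    then show ?thesis
      using complex_normed_space_cong[OF sp0.normed.complex_normed_space_axioms] Z_0 by simp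
  next
    case 2
    then show ?thesis
      using complex_normed_space_cong[OF sp1.normed.complex_normed_space_axioms] Z_1 by simp
  next
    case 3
    then show ?thesis using regularity unfolding elliptic_regularity_def by blast
  qed
qed

lemma Z_subset_H0: "j \<le> l + 1 \<Longrightarrow> Z j \<subseteq> H0"
proof (induction j)
  case 0
  then show ?case by (simp add: Z_0)
next
  case (Suc j)
  show ?case
  proof (cases "j = 0")
    case True
    then show ?thesis using inclusion by (simp add: Z_1)
  next
    case False
    then have "Suc j \<in> {2..l + 1}" using Suc.prems by auto
    then have "Z (Suc j) \<subseteq> Z (Suc j - 1)"
      using regularity unfolding elliptic_regularity_def by blast
    then show ?thesis using Suc by auto
  qed
qed

text \<open>If \<open>b u\<close> is represented by \<open>y\<close> in \<open>Z j\<close>, duality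
  bounds the supremum in \<open>regularity_bound\<close> by \<open>nZ j y\<close>; this settles its
  finiteness and its size at once. Indexing by \<open>j + 2\<close> avoids truncated
  subtraction.\<close>

lemma regularity_estimate:
  assumes u: "u \<in> H" and b: "b \<in> {a, re_form a}" and j: "j + 2 \<le> l + 1"
    and y: "y \<in> Z j" and eq: "\<And>v. v \<in> H \<Longrightarrow> b u v = ip0 y v"
  shows "u \<in> Z (j + 2)" and "nZ (j + 2) u \<le> Cell * (n0 u + nZ j y)"
proof -
  interpret Zj: complex_normed_space smul "Z j" "nZ j" using j by (intro normed_Z) simp
  have ZH0: "x \<in> H0" if "x \<in> Z j" for x using Z_subset_H0[of j] j that by auto
  have "ennreal (cmod (b u v)) \<le> ennreal (nZ j y)"
    if v: "v \<in> H" "pairing_dual_norm ip0 (Z j) (nZ j) v = 1" for v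
  proof -
    have "ennreal (cmod (ip0 v y)) \<le> op_norm (Z j) (nZ j) cmod (ip0 v) * ennreal (nZ j y)"
      using y v(1) ZH0[OF y]
      by (intro Zj.op_norm_bound) (auto simp: sp0.ip_scale_right norm_mult)
    also have "\<dots> = ennreal (nZ j y)" using v(2) by (simp add: pairing_dual_norm_def)
    also have "cmod (ip0 v y) = cmod (b u v)"
      using eq[OF v(1)] sp0.ip_commute[of y v] v(1) ZH0[OF y] by simp
    finally show ?thesis .
  qed
  then have "regularity_bound ip0 H Z nZ Cell b (j + 2) u
      \<le> ennreal Cell * (ennreal (n0 u) + ennreal (nZ j y))"
    unfolding regularity_bound_def by (intro mult_left_mono add_left_mono SUP_least) auto
  also have "\<dots> = ennreal (Cell * (n0 u + nZ j y))"
    using Cell_pos u Zj.norm_nonneg[OF y] by (simp add: ennreal_mult)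
  finally have bound: "regularity_bound ip0 H Z nZ Cell b (j + 2) u \<le> ennreal (Cell * (n0 u + nZ j y))" .
  then have "regularity_bound ip0 H Z nZ Cell b (j + 2) u < \<infinity>"
    by (rule le_less_trans) simp
  moreover have "j + 2 \<in> {2..l + 1}" using j by simp
  ultimately have *: "u \<in> Z (j + 2)" "ennreal (nZ (j + 2) u) \<le> regularity_bound ip0 H Z nZ Cell b (j + 2) u"
    using regularity u b unfolding elliptic_regularity_def by blast+
  show "u \<in> Z (j + 2)" by (rule *)
  have "ennreal (nZ (j + 2) u) \<le> ennreal (Cell * (n0 u + nZ j y))"
    using *(2) bound by (rule order_trans)
  then show "nZ (j + 2) u \<le> Cell * (n0 u + nZ j y)"
    using Cell_pos u Zj.norm_nonneg[OF y] by (simp add: ennreal_le_iff)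
qed

abbreviation "reg \<equiv> \<lambda>j. fst (regularity_const CG1 CG2 Cell j)"

text \<open>For \<open>z = resolvent y\<close> the functional \<open>re_form a z\<close> is
  represented by \<open>y - (CG2 + 1) * z\<close>, so \<open>z\<close> lies two orders above this
  right-hand side. Both \<open>y\<close> and \<open>z\<close> must then be known in
  \<open>Z j\<close>, which is why the induction covers every exponent
  \<open>i \<ge> j\<close>.\<close>

lemma resolvent_pow_regularity:
  assumes "j \<le> l + 1" "j \<le> i" "x \<in> H0"
  shows "resolvent_pow i x \<in> Z j \<and> nZ j (resolvent_pow i x) \<le> reg j * n0 x"
  using assms
proof (induction j arbitrary: i rule: induct_nat_012)
  case 0
  then show ?case using resolvent_pow_contraction[of x i] by (simp add: Z_0)
next
  case 1
  then obtain i' where i: "i = Suc i'" using Suc_le_D by auto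
  let ?y = "resolvent_pow i' x"
  have "nH (resolvent ?y) \<le> n0 ?y / sqrt CG1" using 1 by (intro resolvent_H_bound) simp
  also have "\<dots> \<le> n0 x / sqrt CG1"
    using resolvent_pow_contraction[of x i'] 1 CG1_pos by (intro divide_right_mono) auto
  finally show ?case using 1 by (simp add: i Z_1)
next
  case (ge2 j)
  then obtain i' where i: "i = Suc i'" using Suc_le_D by blast
  let ?y = "resolvent_pow i' x" and ?z = "resolvent_pow i x"
  let ?lam = "complex_of_real (CG2 + 1)"
  have z: "?z = resolvent ?y" by (simp add: i)
  have y: "?y \<in> H0" "?z \<in> H" using ge2 by (simp_all add: i)
  interpret Zj: complex_normed_space smul "Z j" "nZ j" using ge2 by (intro normed_Z) simp
  have IHy: "?y \<in> Z j" "nZ j ?y \<le> reg j * n0 x" using ge2(1)[of i'] ge2 i by auto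
  have IHz: "?z \<in> Z j" "nZ j ?z \<le> reg j * n0 x" using ge2(1)[of i] ge2 by auto
  have eq: "re_form a ?z v = ip0 (?y - smul ?lam ?z) v" if "v \<in> H" for v
    using energy_resolvent[OF y(1) that] that y
    by (simp add: z[symmetric] energy_def sp0.ip_diff_left sp0.ip_scale_left del: of_real_add)
      (metis add_diff_cancel_right')
  have mem: "?y - smul ?lam ?z \<in> Z j" using IHy IHz by (simp del: of_real_add)
  note R = regularity_estimate[where b = "re_form a", OF y(2) _ _ mem eq]
  have "nZ j (?y - smul ?lam ?z) \<le> nZ j ?y + (CG2 + 1) * nZ j ?z"
    using Zj.norm_triangle_diff[OF IHy(1), of "smul ?lam ?z"] IHz(1) CG2_pos
    by (simp add: Zj.norm_scale del: of_real_add)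
  also have "\<dots> \<le> reg j * n0 x + (CG2 + 1) * (reg j * n0 x)"
    using IHy(2) IHz(2) CG2_pos by (intro add_mono mult_left_mono) auto
  finally have "n0 ?z + nZ j (?y - smul ?lam ?z) \<le> n0 x + (CG2 + 2) * reg j * n0 x"
    using resolvent_pow_contraction[of x i] ge2(5) by (simp add: algebra_simps)
  then have "Cell * (n0 ?z + nZ j (?y - smul ?lam ?z)) \<le> Cell * (n0 x + (CG2 + 2) * reg j * n0 x)"
    using Cell_pos by (intro mult_left_mono) auto
  moreover have "nZ (j + 2) ?z \<le> Cell * (n0 ?z + nZ j (?y - smul ?lam ?z))"
    using ge2(3) by (intro R(2)) auto
  moreover have "?z \<in> Z (j + 2)" using ge2(3) by (intro R(1)) auto
  ultimately show ?case by (simp add: algebra_simps)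
qed

lemma smoothing_regularity:
  assumes x: "x \<in> H0"
  shows "smoothing x \<in> Z (l - 1)" and "nZ (l - 1) (smoothing x) \<le> K * reg (l - 1) * n0 x"
proof -
  interpret Zl: complex_normed_space smul "Z (l - 1)" "nZ (l - 1)" by (intro normed_Z) simp
  have *: "resolvent_pow (Suc l) x \<in> Z (l - 1)" "nZ (l - 1) (resolvent_pow (Suc l) x) \<le> reg (l - 1) * n0 x"
    using resolvent_pow_regularity[of "l - 1" "Suc l" x] x by auto
  then show "smoothing x \<in> Z (l - 1)" using Zl.mem_closed(5) by (simp only: smoothing_def)
  show "nZ (l - 1) (smoothing x) \<le> K * reg (l - 1) * n0 x"
    using * K_pos by (simp add: smoothing_def Zl.norm_scale mult.assoc del: funpow.simps One_nat_def)
qed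

text \<open>Regularity is assumed for \<open>a\<close>, not for \<open>modified_form\<close>. Moving
  the perturbation to the right gives \<open>a w v = ip0 (smoothing (e - w)) v\<close>, whose
  right-hand side lies in \<open>Z (l - 1)\<close> as soon as \<open>e\<close> and \<open>w\<close>
  are in \<open>H0\<close>.\<close>

lemma smoothed_dual_solution:
  assumes e: "e \<in> H0"
  obtains w where "w \<in> H" "\<And>v. v \<in> H \<Longrightarrow> modified_form w v = ip0 (smoothing e) v"
    "w \<in> Z (l + 1)" "nZ (l + 1) w \<le> dual_regularity_const CG1 CG2 Cell l * n0 e"
proof -
  have "\<exists>w\<in>H. \<forall>v\<in>H. modified_form w v = ip0 (smoothing e) v"
    using sp1.Lax_Milgram[OF sesquilinear_modified continuous_modified _ modified_coercive(1)
        antidual_ip0[OF smoothing_in[OF e]]] CG1_pos by simp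
  then obtain w where w: "w \<in> H" "\<And>v. v \<in> H \<Longrightarrow> modified_form w v = ip0 (smoothing e) v" by blast
  have "(n0 w)\<^sup>2 / 2 \<le> cmod (ip0 (smoothing e) w)"
    using modified_coercive(2)[OF w(1)] w(2)[OF w(1)] complex_Re_le_cmod[of "ip0 (smoothing e) w"] by simp
  also have "\<dots> \<le> n0 (smoothing e) * n0 w" using e w(1) by (intro sp0.Cauchy_Schwarz) auto
  also have "\<dots> \<le> K * n0 e * n0 w" using smoothing_bound[OF e] w(1) by (intro mult_right_mono) auto
  finally have "n0 w * n0 w \<le> (2 * K * n0 e) * n0 w" by (simp add: power2_eq_square)
  then have w0: "n0 w \<le> 2 * K * n0 e"
    by (rule cancel_nonneg_factor) (use e w(1) K_pos in auto)
  have ew: "e - w \<in> H0" using e w(1) by simp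
  have eq: "a w v = ip0 (smoothing (e - w)) v" if v: "v \<in> H" for v
    using w(2)[OF v] v e w(1)
    by (simp add: modified_form_def smoothing_linear sp0.ip_diff_left eq_diff_eq)
  note S = smoothing_regularity[OF ew]
  \<comment> \<open>Here \<open>l \<ge> 1\<close> enters, as the subtraction is truncated.\<close>
  have l2: "l - 1 + 2 = l + 1" using l_pos by simp
  note R = regularity_estimate[where b = a, OF w(1) _ _ S(1) eq, unfolded l2]
  have regK: "0 \<le> K * reg (l - 1)"
    using K_pos regularity_const_nonneg[OF CG1_pos CG2_pos Cell_pos] by simp
  have "n0 (e - w) \<le> (1 + 2 * K) * n0 e"
    using sp0.normed.norm_triangle_diff[OF e, of w] w(1) w0 by (simp add: algebra_simps)
  then have "K * reg (l - 1) * n0 (e - w) \<le> K * reg (l - 1) * ((1 + 2 * K) * n0 e)"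
    using regK by (rule mult_left_mono)
  then have "n0 w + nZ (l - 1) (smoothing (e - w)) \<le> 2 * K * n0 e + K * reg (l - 1) * ((1 + 2 * K) * n0 e)"
    using S(2) w0 by linarith
  then have "Cell * (n0 w + nZ (l - 1) (smoothing (e - w)))
      \<le> Cell * (2 * K * n0 e + K * reg (l - 1) * ((1 + 2 * K) * n0 e))"
    using Cell_pos by (intro mult_left_mono) auto
  moreover have "nZ (l + 1) w \<le> Cell * (n0 w + nZ (l - 1) (smoothing (e - w)))"
    by (intro R(2)) auto
  ultimately have "nZ (l + 1) w \<le> dual_regularity_const CG1 CG2 Cell l * n0 e"
    by (simp add: dual_regularity_const_def Let_def algebra_simps)
  moreover have "w \<in> Z (l + 1)" by (intro R(1)) auto
  ultimately show ?thesis using that w by blast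
qed

section \<open>The continuous problem and its adjoint\<close>

text \<open>Both vectors solve the problem with right-hand side \<open>a u\<close>, which is a
  bounded antilinear functional.\<close>

lemma solution_unique:
  assumes "u \<in> H" "u' \<in> H" "\<And>v. v \<in> H \<Longrightarrow> a u v = a u' v"
  shows "u = u'"
proof -
  have "a u \<in> antidual smul H ipH"
    unfolding antidual_def using a_bound assms(1)
    by (auto simp: a_add_right a_scale_right intro!: exI[of _ "Ccont * nH u"])
  then have "\<exists>!w. solves a H (a u) w" by (rule unique_solvability)
  moreover have "solves a H (a u) u" "solves a H (a u) u'" using assms by (auto simp: solves_def)
  ultimately show ?thesis by blast
qed

text \<open>Otherwise there are unit vectors \<open>v n\<close> with \<open>a (v n)\<close> tending to zero.  By compactness a
  subsequence converges in \<open>H0\<close>, by the Garding inequality it then converges in \<open>H\<close>, and the limit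
  contradicts uniqueness.\<close>

lemma solution_bound:
  "\<exists>C. \<forall>y\<in>H. \<forall>u\<in>H. (\<forall>v\<in>H. a u v = ipH y v) \<longrightarrow> nH u \<le> C * nH y"
proof (rule ccontr)
  assume "\<not> ?thesis"
  then have "\<forall>C. \<exists>y u. y \<in> H \<and> u \<in> H \<and> (\<forall>v\<in>H. a u v = ipH y v) \<and> C * nH y < nH u"
    by (meson not_le)
  then have "\<forall>n. \<exists>y u. y \<in> H \<and> u \<in> H \<and> (\<forall>v\<in>H. a u v = ipH y v) \<and> real (Suc n) * nH y < nH u" by blast
  then obtain y u where yu: "\<And>n. y n \<in> H" "\<And>n. u n \<in> H" "\<And>n w. w \<in> H \<Longrightarrow> a (u n) w = ipH (y n) w"
    "\<And>n. real (Suc n) * nH (y n) < nH (u n)" by metis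
  have pos: "nH (u n) > 0" for n
    using yu(4)[of n] sp1.ip_norm_nonneg[OF yu(1)[of n]]
    by (smt (verit) mult_nonneg_nonneg of_nat_0_le_iff)
  define v where "v n = smul (complex_of_real (1 / nH (u n))) (u n)" for n
  define g where "g n = smul (complex_of_real (1 / nH (u n))) (y n)" for n
  have v: "v n \<in> H" "nH (v n) = 1" for n
    using yu(2) pos[of n] by (simp_all add: v_def sp1.ip_norm_scale flip: of_real_divide)
  have g: "g n \<in> H" for n using yu(1) by (simp add: g_def)
  have ag: "a (v n) w = ipH (g n) w" if "w \<in> H" for n w
    using yu that by (simp add: v_def g_def a_scale_left sp1.ip_scale_left)
  have "(\<lambda>n. nH (g n)) \<longlonglongrightarrow> 0"
  proof (rule Lim_null_comparison[OF _ LIMSEQ_inverse_real_of_nat], rule always_eventually, rule allI)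
    fix n
    have "nH (g n) = nH (y n) / nH (u n)"
      using yu(1) pos[of n] by (simp add: g_def sp1.ip_norm_scale norm_divide)
    moreover have "nH (y n) / nH (u n) \<le> inverse (real (Suc n))"
      using yu(4)[of n] pos[of n] by (simp add: field_simps)
    ultimately show "norm (nH (g n)) \<le> inverse (real (Suc n))"
      using sp1.ip_norm_nonneg[OF g[of n]] by (simp only: real_norm_def abs_of_nonneg)
  qed
  moreover obtain r x where r: "strict_mono r" "x \<in> H0" and "(\<lambda>n. n0 (v (r n) - x)) \<longlonglongrightarrow> 0"
    using compact_inclusion[of v] v by (metis order_refl)
  ultimately have lims: "(\<lambda>n. nH (g (r n))) \<longlonglongrightarrow> 0" "(\<lambda>n. n0 (v (r n) - x)) \<longlonglongrightarrow> 0"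
    using LIMSEQ_subseq_LIMSEQ[of "\<lambda>n. nH (g n)" 0 r] by (simp_all add: o_def)
  \<comment> \<open>The Garding inequality for a difference of two members splits into one such term
    per index: the residual is doubled because the difference has norm at most 2, the
    \<open>H0\<close> distance because of
    \<open>(s + t)\<^sup>2 \<le> 2 * s\<^sup>2 + 2 * t\<^sup>2\<close>.\<close>
  define q where "q n = 2 * nH (g (r n)) + 2 * CG2 * (n0 (v (r n) - x))\<^sup>2" for n
  have "q \<longlonglongrightarrow> 2 * 0 + 2 * CG2 * 0\<^sup>2"
    unfolding q_def by (intro tendsto_intros lims)
  then have q: "q \<longlonglongrightarrow> 0" by simp
  have Cauchy: "CG1 * (nH (v (r m) - v (r n)))\<^sup>2 \<le> q m + q n" for m n
  proof -
    define d where "d = v (r m) - v (r n)"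
    have d: "d \<in> H" using v by (simp add: d_def)
    have "nH d \<le> 2" using sp1.normed.norm_triangle_diff[OF v(1) v(1)] v(2) by (simp add: d_def)
    have "a d d = ipH (g (r m) - g (r n)) d"
      using v(1) g d ag[OF d] by (simp add: d_def a_diff_left sp1.ip_diff_left)
    then have "Re (a d d) \<le> nH (g (r m) - g (r n)) * nH d"
      using complex_Re_le_cmod[of "a d d"] sp1.Cauchy_Schwarz[of "g (r m) - g (r n)" d] g d by simp
    also have "\<dots> \<le> (nH (g (r m)) + nH (g (r n))) * 2"
      using sp1.normed.norm_triangle_diff[OF g g] \<open>nH d \<le> 2\<close> g d by (intro mult_mono) auto
    finally have 1: "Re (a d d) \<le> 2 * nH (g (r m)) + 2 * nH (g (r n))" by simp
    let ?s = "n0 (v (r m) - x)" and ?t = "n0 (v (r n) - x)"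
    have "n0 d \<le> ?s + ?t"
      using sp0.normed.norm_triangle_diff[of "v (r m) - x" "v (r n) - x"] v(1) r(2) by (simp add: d_def)
    then have "(n0 d)\<^sup>2 \<le> (?s + ?t)\<^sup>2" using d by (intro power_mono) auto
    also have "\<dots> \<le> 2 * ?s\<^sup>2 + 2 * ?t\<^sup>2"
      using zero_le_power2[of "?s - ?t"] by (simp add: power2_sum power2_diff)
    finally have "CG2 * (n0 d)\<^sup>2 \<le> CG2 * (2 * ?s\<^sup>2 + 2 * ?t\<^sup>2)"
      using CG2_pos by (intro mult_left_mono) auto
    moreover have "CG1 * (nH d)\<^sup>2 - CG2 * (n0 d)\<^sup>2 \<le> Re (a d d)"
      using garding_ineq d by (simp add: garding_def)
    ultimately show ?thesis using 1 by (simp add: q_def d_def algebra_simps)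
  qed
  have "\<exists>z\<in>H. (\<lambda>n. nH (v (r n) - z)) \<longlonglongrightarrow> 0"
  proof (rule sp1.complete; intro allI impI)
    fix \<epsilon> :: real assume \<epsilon>: "\<epsilon> > 0"
    then have "\<forall>\<^sub>F n in sequentially. q n < CG1 * \<epsilon>\<^sup>2 / 2"
      using q CG1_pos by (intro order_tendstoD(2)) auto
    then obtain M where M: "\<And>n. n \<ge> M \<Longrightarrow> q n < CG1 * \<epsilon>\<^sup>2 / 2"
      by (auto simp: eventually_sequentially)
    show "\<exists>M. \<forall>m\<ge>M. \<forall>n\<ge>M. nH (v (r m) - v (r n)) < \<epsilon>"
    proof (intro exI[of _ M] allI impI)
      fix m n assume "M \<le> m" "M \<le> n"
      then have "CG1 * (nH (v (r m) - v (r n)))\<^sup>2 < CG1 * \<epsilon>\<^sup>2"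
        using Cauchy[of m n] M[of m] M[of n] by linarith
      then have "(nH (v (r m) - v (r n)))\<^sup>2 < \<epsilon>\<^sup>2" using CG1_pos by simp
      then show "nH (v (r m) - v (r n)) < \<epsilon>" by (rule power2_less_imp_less) (use \<epsilon> in simp)
    qed
  qed (rule v(1))
  then obtain z where z: "z \<in> H" "(\<lambda>n. nH (v (r n) - z)) \<longlonglongrightarrow> 0" by blast
  have "(\<lambda>n. nH (v (r n))) \<longlonglongrightarrow> nH z"
    using v(1) z by (intro sp1.normed.norm_of_limit)
  then have "nH z = 1" using v(2) LIMSEQ_unique[OF _ tendsto_const] by fastforce
  moreover have "a z w = 0" if w: "w \<in> H" for w
  proof -
    have "cmod (a z w) \<le> Ccont * nH (v (r n) - z) * nH w + nH (g (r n)) * nH w" for n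
    proof -
      have "a z w = a (v (r n)) w - a (v (r n) - z) w"
        using v(1) z(1) w by (simp add: a_diff_left)
      then have "cmod (a z w) \<le> cmod (a (v (r n)) w) + cmod (a (v (r n) - z) w)"
        using norm_triangle_ineq4 by metis
      moreover have "cmod (a (v (r n)) w) \<le> nH (g (r n)) * nH w"
        using ag[OF w] sp1.Cauchy_Schwarz[OF g w] by simp
      ultimately show ?thesis using a_bound[of "v (r n) - z" w] v(1) z(1) w by simp
    qed
    moreover have "(\<lambda>n. Ccont * nH (v (r n) - z) * nH w + nH (g (r n)) * nH w)
        \<longlonglongrightarrow> Ccont * 0 * nH w + 0 * nH w"
      by (intro tendsto_intros z lims)
    ultimately have "cmod (a z w) \<le> 0"
      using LIMSEQ_le_const[of _ _ "cmod (a z w)"] by fastforce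
    then show ?thesis by simp
  qed
  then have "z = 0" using z(1) by (intro solution_unique) (auto simp: a_zero)
  ultimately show False by simp
qed

text \<open>The solution operator is transposed: if \<open>U\<close> solves the problem with data
  \<open>ipH y\<close>, then \<open>z\<close> represents the functional \<open>ip0 x (U y)\<close>
  of \<open>y\<close>, and \<open>y = B w\<close> gives the adjoint equation because
  \<open>U (B w) = w\<close>. The constant stems from a compactness argument and so is not explicit;
  it serves only to show that \<open>\<eta>\<close> is finite and enters none of the error
  constants.\<close>

lemma adjoint_problem:
  obtains C where "C \<ge> 0" "\<And>x. x \<in> H0 \<Longrightarrow>
    \<exists>z\<in>H. (\<forall>w\<in>H. a w z = ip0 w x) \<and> nH z \<le> C * n0 x"
proof -
  obtain C0 where C0: "\<And>y u. y \<in> H \<Longrightarrow> u \<in> H \<Longrightarrow> (\<And>v. v \<in> H \<Longrightarrow> a u v = ipH y v) \<Longrightarrow> nH u \<le> C0 * nH y"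
    using solution_bound by blast
  define C where "C = \<bar>C0\<bar>"
  have "\<exists>u. solves a H (ipH y) u" if "y \<in> H" for y
    using unique_solvability[OF sp1.antidual_ip[OF that]] by blast
  then obtain U where U: "\<And>y. y \<in> H \<Longrightarrow> U y \<in> H" "\<And>y v. y \<in> H \<Longrightarrow> v \<in> H \<Longrightarrow> a (U y) v = ipH y v"
    unfolding solves_def by metis
  have UC: "nH (U y) \<le> C * nH y" if y: "y \<in> H" for y
  proof -
    have "nH (U y) \<le> C0 * nH y" using U y by (intro C0) auto
    also have "\<dots> \<le> C * nH y" using y by (intro mult_right_mono) (auto simp: C_def)
    finally show ?thesis .
  qed
  have Uadd: "U (x + y) = U x + U y" if "x \<in> H" "y \<in> H" for x y
    using that U by (intro solution_unique) (simp_all add: a_add_left sp1.ip_add_left)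
  have Uscale: "U (smul c x) = smul c (U x)" if "x \<in> H" for c x
    using that U by (intro solution_unique) (simp_all add: a_scale_left sp1.ip_scale_left)
  obtain B where B: "\<And>u. u \<in> H \<Longrightarrow> B u \<in> H" "\<And>u v. u \<in> H \<Longrightarrow> v \<in> H \<Longrightarrow> ipH (B u) v = a u v"
    using sp1.representing_operator[OF sesquilinear continuous] by blast
  have UB: "U (B w) = w" if "w \<in> H" for w
    using that U B by (intro solution_unique) simp_all
  have "\<exists>z\<in>H. (\<forall>w\<in>H. a w z = ip0 w x) \<and> nH z \<le> (C * Cemb) * n0 x" if x: "x \<in> H0" for x
  proof -
    have bound: "cmod (ip0 x (U y)) \<le> n0 x * Cemb * C * nH y" if y: "y \<in> H" for y
    proof -
      have "cmod (ip0 x (U y)) \<le> n0 x * Cemb * nH (U y)" using x U(1)[OF y] by (rule ip0_bound)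
      also have "\<dots> \<le> n0 x * Cemb * (C * nH y)"
        using UC[OF y] x Cemb_pos by (intro mult_left_mono) auto
      finally show ?thesis by (simp add: mult.assoc)
    qed
    have "(\<lambda>y. ip0 x (U y)) \<in> antidual smul H ipH"
      unfolding antidual_def using bound U(1) x
      by (auto simp: Uadd Uscale sp0.ip_add_right sp0.ip_scale_right intro!: exI[of _ "n0 x * Cemb * C"])
    then obtain z where z: "z \<in> H" "\<And>y. y \<in> H \<Longrightarrow> ipH z y = ip0 x (U y)"
      using sp1.Riesz_representation by blast
    have "a w z = ip0 w x" if w: "w \<in> H" for w
      using B(2)[OF w z(1)] z(2)[OF B(1)[OF w]] UB[OF w] sp1.ip_commute[OF z(1) B(1)[OF w]]
        sp0.ip_commute[of x w] x w by simp
    moreover have "nH z \<le> (C * Cemb) * n0 x"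
    proof (rule cancel_nonneg_factor[where z = "nH z"])
      have "nH z * nH z = cmod (ip0 x (U z))"
        using z(1) by (simp add: z(2)[OF z(1), symmetric] sp1.ip_self norm_mult power2_eq_square)
      then show "nH z * nH z \<le> C * Cemb * n0 x * nH z" using bound[OF z(1)] by (simp add: mult_ac)
    qed (use z(1) x Cemb_pos in \<open>auto simp: C_def\<close>)
    ultimately show ?thesis using z(1) by blast
  qed
  moreover have "0 \<le> C * Cemb" using Cemb_pos by (simp add: C_def)
  ultimately show ?thesis using that by blast
qed

text \<open>Existence for the original problem yields uniqueness for the adjoint one: the difference
  is tested with the solution \<open>w\<close> for the data \<open>ipH (z - z')\<close>.\<close>

lemma adjoint_unique:
  assumes "z \<in> H" "z' \<in> H" "\<And>w. w \<in> H \<Longrightarrow> a w z = a w z'"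
  shows "z = z'"
proof -
  obtain w where w: "solves a H (ipH (z - z')) w"
    using unique_solvability[OF sp1.antidual_ip[of "z - z'"]] assms by auto
  then have "w \<in> H" "a w (z - z') = ipH (z - z') (z - z')" using assms by (auto simp: solves_def)
  then have "ipH (z - z') (z - z') = 0" using assms by (simp add: a_diff_right)
  then show ?thesis using sp1.ip_pos[of "z - z'"] assms by fastforce
qed

abbreviation "adj x \<equiv> adjoint_solution H a (ip0 x)"

lemma adjoint_solution:
  assumes x: "x \<in> H0"
  shows "adj x \<in> H" and "w \<in> H \<Longrightarrow> a w (adj x) = ip0 w x"
    and "z \<in> H \<Longrightarrow> (\<And>w. w \<in> H \<Longrightarrow> a w z = ip0 w x) \<Longrightarrow> adj x = z"
proof -
  have eq: "cnj (ip0 x w) = ip0 w x" if "w \<in> H" for w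
    using sp0.ip_commute[of x w] x that by simp
  obtain z0 where z0: "z0 \<in> H" "\<And>w. w \<in> H \<Longrightarrow> a w z0 = ip0 w x"
    using adjoint_problem x by metis
  have ex1: "\<exists>!z. z \<in> H \<and> (\<forall>w\<in>H. a w z = cnj (ip0 x w))"
    using z0 eq adjoint_unique by (intro ex1I[of _ z0]) auto
  from theI'[OF ex1] show "adj x \<in> H" "w \<in> H \<Longrightarrow> a w (adj x) = ip0 w x"
    by (auto simp: adjoint_solution_def eq)
  show "adj x = z" if "z \<in> H" "\<And>w. w \<in> H \<Longrightarrow> a w z = ip0 w x" for z
    unfolding adjoint_solution_def by (rule the1_equality[OF ex1]) (use that eq in simp)
qed

lemma adjoint_solution_bound: "\<exists>C\<ge>0. \<forall>x\<in>H0. nH (adj x) \<le> C * n0 x"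
  using adjoint_problem adjoint_solution(3) by metis

lemma adjoint_solution_scale: "x \<in> H0 \<Longrightarrow> adj (smul c x) = smul c (adj x)"
  by (rule adjoint_solution(3))
    (simp_all add: adjoint_solution(1,2) a_scale_right sp0.ip_scale_right)

end

section \<open>Constants of the error bounds\<close>

text \<open>One factor of the continuity constant comes from continuity itself, the other, over the
  coercivity constant \<open>CG1 / 2\<close>, from Cea's estimate for the perturbed form.\<close>

definition duality_const :: "real \<Rightarrow> real \<Rightarrow> real \<Rightarrow> real \<Rightarrow> nat \<Rightarrow> real" where
  "duality_const Ccont CG1 CG2 Cemb l = (modified_cont_const Ccont CG2 Cemb l)\<^sup>2 / (CG1 / 2)"

text \<open>Chosen so that its product with the duality and the dual regularity constants is
  \<open>1 / 2\<close>: the contribution of \<open>w\<close> is then half of the left-hand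
  side.\<close>

definition mesh_const :: "real \<Rightarrow> real \<Rightarrow> real \<Rightarrow> real \<Rightarrow> real \<Rightarrow> nat \<Rightarrow> real" where
  "mesh_const Ccont CG1 CG2 Cell Cemb l =
    1 / (2 * duality_const Ccont CG1 CG2 Cemb l * dual_regularity_const CG1 CG2 Cell l)"

text \<open>\<open>Ccont\<close> comes from Galerkin orthogonality, the second summand from the
  \<open>H0\<close> term of the Garding inequality.\<close>

definition energy_error_const :: "real \<Rightarrow> real \<Rightarrow> real \<Rightarrow> real \<Rightarrow> nat \<Rightarrow> real" where
  "energy_error_const Ccont CG1 CG2 Cemb l =
    (Ccont + CG2 * Cemb * (2 * duality_const Ccont CG1 CG2 Cemb l)) / CG1"

lemma constants_pos:
  assumes "Ccont > 0" "CG1 > 0" "CG2 > 0" "Cell > 0" "Cemb > 0"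
  shows "modified_cont_const Ccont CG2 Cemb l > 0"
    and "dual_regularity_const CG1 CG2 Cell l > 0"
    and "duality_const Ccont CG1 CG2 Cemb l > 0"
    and "mesh_const Ccont CG1 CG2 Cell Cemb l > 0"
    and "energy_error_const Ccont CG1 CG2 Cemb l > 0"
proof -
  have K: "smoothing_const CG2 l > 0" using assms by (simp add: smoothing_const_def)
  then show M: "modified_cont_const Ccont CG2 Cemb l > 0"
    using assms by (simp add: modified_cont_const_def add_pos_nonneg)
  show W: "dual_regularity_const CG1 CG2 Cell l > 0"
    using assms K regularity_const_nonneg[of CG1 CG2 Cell "l - 1"]
    by (simp add: dual_regularity_const_def Let_def add_pos_nonneg del: One_nat_def)
  show Q: "duality_const Ccont CG1 CG2 Cemb l > 0"
    using M assms by (simp add: duality_const_def)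
  show "mesh_const Ccont CG1 CG2 Cell Cemb l > 0"
    using Q W by (simp add: mesh_const_def)
  show "energy_error_const Ccont CG1 CG2 Cemb l > 0"
    using Q assms by (simp add: energy_error_const_def add_pos_pos)
qed

section \<open>The discrete space and the duality argument\<close>

locale galerkin_discretization = galerkin_analysis +
  fixes h :: real
  assumes h_pos: "h > 0"
begin

abbreviation "V \<equiv> Hh h"
abbreviation "pe \<equiv> proj_error ipH V"
abbreviation "\<eta> \<equiv> adjoint_approximability H0 ip0 H ipH a V"
abbreviation "\<delta> \<equiv> op_norm (Z (l + 1)) (nZ (l + 1)) nH pe"
abbreviation "M \<equiv> modified_cont_const Ccont CG2 Cemb l"
abbreviation "W \<equiv> dual_regularity_const CG1 CG2 Cell l"
abbreviation "Q \<equiv> duality_const Ccont CG1 CG2 Cemb l"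

lemmas const_pos = constants_pos[OF Ccont_pos CG1_pos CG2_pos Cell_pos Cemb_pos, where l = l]
  and const_nonneg [simp] = constants_pos[OF Ccont_pos CG1_pos CG2_pos Cell_pos Cemb_pos, where l = l, THEN less_imp_le]

lemma V_span: obtains B where "V = sp0.span B" "finite B" "B \<subseteq> H"
proof -
  obtain B where "finite B" "V = sp0.span B" "V \<subseteq> H" using discrete_spaces[OF h_pos] by blast
  then show ?thesis using that[of B] sp0.span_superset[of B] by simp
qed

lemma V_subset [simp]: "x \<in> V \<Longrightarrow> x \<in> H"
  using discrete_spaces[OF h_pos] by blast

lemma V_closed [simp]: "x \<in> V \<Longrightarrow> y \<in> V \<Longrightarrow> x + y \<in> V" "x \<in> V \<Longrightarrow> y \<in> V \<Longrightarrow> x - y \<in> V" "0 \<in> V"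
proof -
  obtain B where "V = sp0.span B" by (rule V_span)
  then show "x \<in> V \<Longrightarrow> y \<in> V \<Longrightarrow> x + y \<in> V" "x \<in> V \<Longrightarrow> y \<in> V \<Longrightarrow> x - y \<in> V" "0 \<in> V"
    by (simp_all add: sp0.span_add sp0.span_diff sp0.span_zero)
qed

lemma pe:
  assumes "x \<in> H"
  shows pe_in [simp]: "pe x \<in> H"
    and pe_V: "x - pe x \<in> V"
    and pe_scale: "pe (smul c x) = smul c (pe x)"
    and pe_le: "nH (pe x) \<le> nH x"
proof -
  obtain B where B: "V = sp0.span B" "finite B" "B \<subseteq> H" by (rule V_span)
  note P = sp1.proj_error[OF B assms]
  show "pe x \<in> H" "pe (smul c x) = smul c (pe x)" "nH (pe x) \<le> nH x"
    by (rule P(1), rule P(2), rule P(3))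
  show "x - pe x \<in> V" using sp1.orth_proj(1)[OF B assms] by (simp add: proj_error_def)
qed

lemma pe_0 [simp]: "pe 0 = 0"
proof -
  have "pe (smul 0 0) = smul 0 (pe 0)" by (rule pe_scale) simp
  then show ?thesis by (simp only: sp0.scale_zero_left)
qed

text \<open>The unknown sits in the antilinear argument; conjugating the form with its arguments
  swapped makes it linear in the unknown. Coercivity supplies nondegeneracy.\<close>

lemma modified_adjoint_projection:
  assumes z: "z \<in> H"
  obtains zh where "zh \<in> V" "\<And>v. v \<in> V \<Longrightarrow> modified_form v (z - zh) = 0"
proof -
  obtain B where B: "V = sp0.span B" "finite B" "B \<subseteq> H" by (rule V_span)
  note sesq = sesquilinear_onD[OF sesquilinear_modified]
  have inH: "x \<in> H" if "x \<in> sp0.span B" for x using that B(1) V_subset by simp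
  have "\<exists>u\<in>sp0.span B. \<forall>v\<in>sp0.span B. cnj (modified_form v u) = cnj (modified_form v z)"
  proof (rule sp1.nondegenerate_form_span[OF B(2,3)])
    show "sesquilinear_on smul (sp0.span B) (\<lambda>u v. cnj (modified_form v u))"
      by (rule sesquilinear_onI) (simp_all add: inH sesq)
    show "u = 0" if u: "u \<in> sp0.span B" "\<And>v. v \<in> sp0.span B \<Longrightarrow> cnj (modified_form v u) = 0" for u
    proof -
      have "(n0 u)\<^sup>2 / 2 \<le> 0"
        using modified_coercive(2)[OF inH[OF u(1)]] u(2)[OF u(1)] by simp
      then show ?thesis using inH[OF u(1)] by (simp add: sp0.ip_norm_eq_0)
    qed
  qed (use z in \<open>simp_all add: inH sesq\<close>)
  then obtain zh where zh: "zh \<in> V" "\<And>v. v \<in> V \<Longrightarrow> modified_form v zh = modified_form v z"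
    unfolding B(1)[symmetric] by auto
  have "modified_form v (z - zh) = 0" if "v \<in> V" for v
    using sesquilinear_on_diff(2)[OF sesquilinear_modified sp0.vector_space_axioms sp1.subspace_carrier,
        of z zh v] zh that z by simp
  then show ?thesis using zh(1) that by blast
qed

text \<open>For \<open>x = z\<close>, orthogonality and coercivity give Cea's estimate for
  \<open>z - zh\<close>. Orthogonality for the given \<open>x\<close> then brings in the second
  projection error.\<close>

lemma modified_projection_error:
  assumes z: "z \<in> H" and zh: "zh \<in> V" "\<And>v. v \<in> V \<Longrightarrow> modified_form v (z - zh) = 0"
    and x: "x \<in> H"
  shows "cmod (modified_form x (z - zh)) \<le> Q * nH (pe x) * nH (pe z)"
proof -
  have d: "z - zh \<in> H" using z zh by simp
  note sesq_diff = sesquilinear_on_diff(1)[OF sesquilinear_modified sp0.vector_space_axioms sp1.subspace_carrier]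
  have reduce: "modified_form x (z - zh) = modified_form (pe x) (z - zh)" if x: "x \<in> H" for x
    using zh(2)[OF pe_V[OF x]] sesq_diff[OF x pe_in[OF x] d] by simp
  have bound: "cmod (modified_form x (z - zh)) \<le> M * nH (pe x) * nH (z - zh)" if x: "x \<in> H" for x
    using reduce[OF x] continuous_modified d pe_in[OF x] by (simp add: continuous_form_def)
  have "CG1 / 2 * (nH (z - zh))\<^sup>2 \<le> cmod (modified_form (z - zh) (z - zh))"
    using modified_coercive(1)[OF d] complex_Re_le_cmod order_trans by blast
  also have "modified_form (z - zh) (z - zh) = modified_form z (z - zh)"
    using sesq_diff[OF z _ d, of zh] zh by simp
  also have "cmod \<dots> \<le> M * nH (pe z) * nH (z - zh)" by (rule bound[OF z])
  finally have "(CG1 / 2 * nH (z - zh)) * nH (z - zh) \<le> (M * nH (pe z)) * nH (z - zh)"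
    by (simp add: power2_eq_square mult.assoc)
  then have "CG1 / 2 * nH (z - zh) \<le> M * nH (pe z)"
    by (rule cancel_nonneg_factor) (use d z in auto)
  then have cea: "nH (z - zh) \<le> M * nH (pe z) / (CG1 / 2)" using CG1_pos by (simp add: field_simps)
  show "cmod (modified_form x (z - zh)) \<le> Q * nH (pe x) * nH (pe z)"
  proof -
    have "M * nH (pe x) * nH (z - zh) \<le> M * nH (pe x) * (M * nH (pe z) / (CG1 / 2))"
      using cea const_pos(1) x by (intro mult_left_mono) auto
    then show ?thesis
      using bound[OF x] by (simp add: duality_const_def power2_eq_square mult_ac)
  qed
qed

lemma duality_estimate:
  assumes u: "u \<in> H" and uh: "uh \<in> V" and orth: "\<And>v. v \<in> V \<Longrightarrow> a (u - uh) v = 0"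
  shows "\<exists>w\<in>Z (l + 1) \<inter> H. nZ (l + 1) w \<le> W * n0 (u - uh) \<and>
    (n0 (u - uh))\<^sup>2 \<le> Q * (nH (pe u) + nH (pe w)) * nH (pe (adj (u - uh)))"
proof -
  define e where "e = u - uh"
  have e: "e \<in> H" using u uh by (simp add: e_def)
  obtain w where w: "w \<in> H" "\<And>v. v \<in> H \<Longrightarrow> modified_form w v = ip0 (smoothing e) v"
    "w \<in> Z (l + 1)" "nZ (l + 1) w \<le> W * n0 e"
    using smoothed_dual_solution[of e] e by auto
  define z where "z = adj e"
  have z: "z \<in> H" "a e z = ip0 e e" using adjoint_solution e by (simp_all add: z_def)
  obtain zh where zh: "zh \<in> V" "\<And>v. v \<in> V \<Longrightarrow> modified_form v (z - zh) = 0"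
    using modified_adjoint_projection[OF z(1)] by blast
  have E: "cmod (modified_form x (z - zh)) \<le> Q * nH (pe x) * nH (pe z)" if "x \<in> H" for x
    by (rule modified_projection_error[OF z(1)]) (use zh that in auto)
  have d: "z - zh \<in> H" using z zh by simp
  have "ip0 e e = a e (z - zh)"
    using orth[OF zh(1), folded e_def] z e zh(1) by (simp add: a_diff_right)
  \<comment> \<open>The perturbation is added and subtracted; \<open>w\<close> is defined so that
    the subtracted term is again a value of \<open>modified_form\<close> at
    \<open>z - zh\<close>.\<close>
  also have "\<dots> = modified_form e (z - zh) - modified_form w (z - zh)"
    using w(2)[OF d] by (simp add: modified_form_def)
  also have "modified_form e (z - zh) = modified_form u (z - zh)"
    using sesquilinear_on_diff(1)[OF sesquilinear_modified sp0.vector_space_axioms sp1.subspace_carrier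
        u _ d, of uh] zh(2)[OF uh] uh by (simp add: e_def)
  finally have "cmod (ip0 e e) \<le> cmod (modified_form u (z - zh)) + cmod (modified_form w (z - zh))"
    by (simp add: norm_triangle_ineq4)
  moreover have "cmod (ip0 e e) = (n0 e)\<^sup>2"
    using e by (simp add: sp0.ip_self norm_power)
  ultimately have "(n0 e)\<^sup>2 \<le> Q * nH (pe u) * nH (pe z) + Q * nH (pe w) * nH (pe z)"
    using E[OF u] E[OF w(1)] by linarith
  then have "(n0 e)\<^sup>2 \<le> Q * (nH (pe u) + nH (pe w)) * nH (pe z)" by (simp add: algebra_simps)
  then show ?thesis using w unfolding z_def e_def by blast
qed

lemma adjoint_approximability_bound:
  assumes "x \<in> H0"
  shows "ennreal (nH (pe (adj x))) \<le> \<eta> * ennreal (n0 x)"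
  unfolding adjoint_approximability_def
proof (rule sp0.normed.op_norm_bound[OF assms])
  show "nH (pe (adj (smul (complex_of_real r) x))) = r * nH (pe (adj x))" if "r > 0" for r
    using that assms by (simp add: adjoint_solution adjoint_solution_scale pe_scale sp1.ip_norm_scale)
  have "adj (smul 0 0) = smul 0 (adj 0)" by (rule adjoint_solution_scale) simp
  then show "nH (pe (adj 0)) = 0" by (simp only: sp0.scale_zero_left pe_0 sp1.normed.norm_zero)
qed

lemma approximability_bound:
  assumes "x \<in> Z (l + 1)" "x \<in> H"
  shows "ennreal (nH (pe x)) \<le> \<delta> * ennreal (nZ (l + 1) x)"
proof -
  interpret Zl: complex_normed_space smul "Z (l + 1)" "nZ (l + 1)" by (rule normed_Z) simp
  show ?thesis
  proof (rule Zl.op_norm_bound[OF assms(1)])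
    show "nH (pe (smul (complex_of_real r) x)) = r * nH (pe x)" if "r > 0" for r
      using that assms(2) by (simp add: pe_scale sp1.ip_norm_scale)
  qed simp
qed

text \<open>The projection does not increase norms, so boundedness of the adjoint solution operator
  suffices. Finiteness allows \<open>\<eta>\<close> to be treated as a real number in the error
  estimates.\<close>

lemma adjoint_approximability_finite: "\<eta> < \<infinity>"
proof -
  obtain C where C: "C \<ge> 0" "\<And>x. x \<in> H0 \<Longrightarrow> nH (adj x) \<le> C * n0 x"
    using adjoint_solution_bound by blast
  have "\<eta> \<le> ennreal C"
    unfolding adjoint_approximability_def op_norm_def
  proof (rule SUP_least)
    fix x assume "x \<in> {x \<in> H0. n0 x = 1}"
    then have x: "x \<in> H0" "n0 x = 1" by auto
    have "nH (pe (adj x)) \<le> C"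
      using pe_le[OF adjoint_solution(1)[OF x(1)]] C(2)[OF x(1)] x(2) by simp
    then show "ennreal (nH (pe (adj x))) \<le> ennreal C" by (rule ennreal_leI)
  qed
  then show ?thesis by (rule le_less_trans) simp
qed

section \<open>Galerkin error bounds and solvability\<close>

text \<open>Stated for any pair with Galerkin orthogonality, so that it applies before discrete
  solvability is known.\<close>

lemma Galerkin_errors:
  assumes u: "u \<in> H" and uh: "uh \<in> V" and orth: "\<And>v. v \<in> V \<Longrightarrow> a (u - uh) v = 0"
    and mesh: "\<eta> * \<delta> \<le> ennreal (mesh_const Ccont CG1 CG2 Cell Cemb l)"
  shows "ennreal (n0 (u - uh)) \<le> ennreal (2 * Q) * \<eta> * ennreal (nH (pe u))"
    and "ennreal (nH (u - uh))
      \<le> ennreal (energy_error_const Ccont CG1 CG2 Cemb l) * (1 + \<eta>) * ennreal (nH (pe u))"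
proof -
  define e where "e = u - uh"
  have e: "e \<in> H" using u uh by (simp add: e_def)
  obtain r where r: "r \<ge> 0" "\<eta> = ennreal r"
    using adjoint_approximability_finite by (cases \<eta>) auto
  let ?p = "nH (pe u)" and ?q = "nH (pe (adj e))"
  let ?C1 = "mesh_const Ccont CG1 CG2 Cell Cemb l"
  have p: "?p \<ge> 0" using u by simp
  have q: "?q \<ge> 0" using adjoint_solution(1) e by simp
  obtain w where w: "w \<in> Z (l + 1)" "w \<in> H" "nZ (l + 1) w \<le> W * n0 e"
    "(n0 e)\<^sup>2 \<le> Q * (?p + nH (pe w)) * ?q"
    using duality_estimate[OF u uh orth, folded e_def] by auto
  have ne: "n0 e \<ge> 0" using e by simp
  have "ennreal ?q \<le> ennreal (r * n0 e)"
    using adjoint_approximability_bound[of e] e r by (simp add: ennreal_mult)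
  then have qr: "?q \<le> r * n0 e" using r ne by (simp add: ennreal_le_iff)
  \<comment> \<open>The factors are multiplied in \<open>ennreal\<close> since
    \<open>\<delta>\<close> has not been shown to be finite; only the product
    \<open>\<eta> * \<delta>\<close> is controlled.\<close>
  have "ennreal (nH (pe w) * ?q) \<le> (\<delta> * ennreal (nZ (l + 1) w)) * (\<eta> * ennreal (n0 e))"
    using approximability_bound[OF w(1,2)] adjoint_approximability_bound[of e] e w(2) q
    by (simp add: ennreal_mult mult_mono)
  also have "\<dots> = (\<eta> * \<delta>) * (ennreal (nZ (l + 1) w) * ennreal (n0 e))" by (simp add: mult_ac)
  also have "\<dots> \<le> ennreal ?C1 * (ennreal (W * n0 e) * ennreal (n0 e))"
    using mesh w(3) by (intro mult_mono) (auto intro: ennreal_leI)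
  also have "\<dots> = ennreal (?C1 * (W * n0 e * n0 e))"
    using ne by (simp add: ennreal_mult)
  finally have "nH (pe w) * ?q \<le> ?C1 * (W * n0 e * n0 e)"
    using ne by (simp add: ennreal_le_iff)
  then have "Q * (nH (pe w) * ?q) \<le> Q * (?C1 * (W * n0 e * n0 e))"
    using const_pos(3) by (intro mult_left_mono) auto
  also have "\<dots> = (n0 e)\<^sup>2 / 2"
    using const_pos(2,3) by (simp add: mesh_const_def power2_eq_square field_simps)
  finally have "(n0 e)\<^sup>2 \<le> 2 * (Q * ?p * ?q)"
    using w(4) by (simp add: algebra_simps)
  also have "\<dots> \<le> 2 * (Q * ?p * (r * n0 e))"
    using qr p const_pos(3) by (intro mult_left_mono) auto
  finally have "n0 e * n0 e \<le> (2 * Q * r * ?p) * n0 e" by (simp add: power2_eq_square mult_ac)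
  then have L2: "n0 e \<le> 2 * Q * r * ?p"
    by (rule cancel_nonneg_factor) (use ne r p const_pos(3) in auto)
  then show "ennreal (n0 (u - uh)) \<le> ennreal (2 * Q) * \<eta> * ennreal ?p"
    using r p const_pos(3) by (simp add: e_def ennreal_leI flip: ennreal_mult)
  \<comment> \<open>\<open>e\<close> differs from \<open>pe u\<close> by a member of
    \<open>V\<close>, to which the error is orthogonal.\<close>
  have "a e e = a e (pe u) + a e (u - pe u - uh)"
    using e u uh by (simp add: e_def a_add_right[symmetric])
  also have "a e (u - pe u - uh) = 0"
    using orth[of "u - pe u - uh"] pe_V[OF u] uh by (simp add: e_def)
  finally have "Re (a e e) \<le> Ccont * nH e * ?p"
    using a_bound[OF e pe_in[OF u]] complex_Re_le_cmod[of "a e (pe u)"] by simp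
  moreover have "CG1 * (nH e)\<^sup>2 - CG2 * (n0 e)\<^sup>2 \<le> Re (a e e)"
    using garding_ineq e by (simp add: garding_def)
  \<comment> \<open>One factor \<open>n0 e\<close> is bounded by the estimate just proved, the other
    by the embedding, so that \<open>nH e\<close> can be cancelled.\<close>
  moreover have "CG2 * (n0 e)\<^sup>2 \<le> CG2 * ((2 * Q * r * ?p) * (Cemb * nH e))"
    using L2 inclusion_bound[OF e] ne CG2_pos r p const_pos(3)
    unfolding power2_eq_square by (intro mult_left_mono mult_mono) auto
  ultimately have "(CG1 * nH e) * nH e \<le> ((Ccont + CG2 * Cemb * (2 * Q) * r) * ?p) * nH e"
    by (simp add: power2_eq_square algebra_simps)
  then have "CG1 * nH e \<le> (Ccont + CG2 * Cemb * (2 * Q) * r) * ?p"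
    by (rule cancel_nonneg_factor)
      (use e r p const_pos(3) Ccont_pos CG2_pos Cemb_pos in auto)
  also have "\<dots> \<le> ((Ccont + CG2 * Cemb * (2 * Q)) * (1 + r)) * ?p"
    using r p const_pos(3) Ccont_pos CG2_pos Cemb_pos
    by (intro mult_right_mono) (auto simp: algebra_simps)
  finally have "nH e \<le> energy_error_const Ccont CG1 CG2 Cemb l * (1 + r) * ?p"
    using CG1_pos by (simp add: energy_error_const_def field_simps)
  then have "ennreal (nH e) \<le> ennreal (energy_error_const Ccont CG1 CG2 Cemb l * (1 + r) * ?p)"
    by (rule ennreal_leI)
  also have "\<dots> = ennreal (energy_error_const Ccont CG1 CG2 Cemb l) * (1 + \<eta>) * ennreal ?p"
    using r p const_pos(5) by (simp add: ennreal_mult)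
  finally show "ennreal (nH (u - uh))
      \<le> ennreal (energy_error_const Ccont CG1 CG2 Cemb l) * (1 + \<eta>) * ennreal ?p"
    by (simp add: e_def)
qed

lemma Galerkin_orthogonality:
  assumes "solves a H g u" "solves a V g uh" "v \<in> V"
  shows "a (u - uh) v = 0"
  using assms by (simp add: solves_def a_diff_left)

text \<open>A discrete solution of the homogeneous equations is a Galerkin approximation of 0, whose
  projection error vanishes; the error bound forces it to be 0, and finite dimension turns
  uniqueness into existence.\<close>

lemma Galerkin_well_posed:
  assumes g: "g \<in> antidual smul H ipH"
    and mesh: "\<eta> * \<delta> \<le> ennreal (mesh_const Ccont CG1 CG2 Cell Cemb l)"
  shows "\<exists>!uh. solves a V g uh"
proof -
  have zero: "x = 0" if x: "x \<in> V" "\<And>v. v \<in> V \<Longrightarrow> a x v = 0" for x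
  proof -
    have "ennreal (n0 (0 - x)) \<le> ennreal (2 * Q) * \<eta> * ennreal (nH (pe 0))"
    proof (rule Galerkin_errors(1)[OF _ x(1) _ mesh])
      show "a (0 - x) v = 0" if "v \<in> V" for v
        using x that sp1.mem_closed(1) by (simp only: a_diff_left V_subset a_zero) simp
    qed simp
    then have "n0 (0 - x) \<le> 0" by (simp add: ennreal_eq_0_iff)
    moreover have "0 - x \<in> H0" using x(1) by simp
    ultimately have "0 - x = 0" using sp0.ip_norm_eq_0 sp0.ip_norm_nonneg by (metis order_antisym)
    then show ?thesis by simp
  qed
  obtain B where B: "V = sp0.span B" "finite B" "B \<subseteq> H" by (rule V_span)
  have "\<exists>u\<in>sp0.span B. \<forall>v\<in>sp0.span B. a u v = g v"
    using zero sesquilinear_on_subset[OF sesquilinear, of V] discrete_spaces[OF h_pos] sp1.antidualD(1,2)[OF g]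
    by (intro sp1.nondegenerate_form_span[OF B(2,3)]) (auto simp flip: B(1))
  then obtain uh where uh: "solves a V g uh" unfolding solves_def B(1) by blast
  have "x = uh" if x: "solves a V g x" for x
  proof -
    have "a (x - uh) v = 0" if "v \<in> V" for v
      using x uh that by (simp add: solves_def a_diff_left)
    then have "x - uh = 0" using x uh by (intro zero) (auto simp: solves_def)
    then show ?thesis by simp
  qed
  with uh show ?thesis by blast
qed

text \<open>The oscillation bound and continuity of \<open>a\<close> control the norm of
  \<open>G\<close> in \<open>Z (l - 1)\<close> by \<open>nH u\<close>. Regularity then places
  \<open>u\<close> in \<open>Z (l + 1)\<close> with norm at most a multiple of \<open>nH u\<close>,
  so \<open>nH (pe u)\<close> is at most \<open>\<delta>\<close> times that multiple.\<close>

lemma relative_error: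
  assumes u: "solves a H g u" and uh: "solves a V g uh"
    and G: "G \<in> Z (l - 1)" "\<And>v. v \<in> H \<Longrightarrow> g v = ip0 G v"
    and osc: "ennreal (nZ (l - 1) G) \<le> ennreal Cosc * antidual_norm H ipH g" and Cosc: "Cosc > 0"
    and mesh: "\<eta> * \<delta> \<le> ennreal (mesh_const Ccont CG1 CG2 Cell Cemb l)"
  shows "ennreal (nH (u - uh) / nH u)
    \<le> ennreal (energy_error_const Ccont CG1 CG2 Cemb l * (Cell * (Cemb + Cosc * Ccont))) * (1 + \<eta>) * \<delta>"
proof (cases "u = 0")
  \<comment> \<open>The relative error is then a division by zero, hence 0.\<close>
  case True
  then show ?thesis by simp
next
  case False
  have uH: "u \<in> H" and uhV: "uh \<in> V" using u uh by (auto simp: solves_def)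
  have nu: "nH u > 0" using False uH sp1.ip_norm_eq_0[OF uH] by (simp add: less_le)
  have "antidual_norm H ipH g \<le> ennreal (Ccont * nH u)"
    unfolding antidual_norm_def op_norm_def
  proof (rule SUP_least)
    fix v assume "v \<in> {v \<in> H. nH v = 1}"
    then have v: "v \<in> H" "nH v = 1" by auto
    have "cmod (g v) \<le> Ccont * nH u" using a_bound[OF uH v(1)] v u by (simp add: solves_def)
    then show "ennreal (cmod (g v)) \<le> ennreal (Ccont * nH u)" by (rule ennreal_leI)
  qed
  then have "ennreal Cosc * antidual_norm H ipH g \<le> ennreal Cosc * ennreal (Ccont * nH u)"
    by (rule mult_left_mono) simp
  from order_trans[OF osc this] have "ennreal (nZ (l - 1) G) \<le> ennreal (Cosc * (Ccont * nH u))"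
    using Cosc by (simp only: ennreal_mult' less_imp_le)
  then have nG: "nZ (l - 1) G \<le> Cosc * (Ccont * nH u)"
    using Cosc Ccont_pos nu by (simp add: ennreal_le_iff)
  have l2: "l - 1 + 2 = l + 1" using l_pos by simp
  have eq: "a u v = ip0 G v" if "v \<in> H" for v using u G(2)[OF that] that by (simp add: solves_def)
  note R = regularity_estimate[where b = a, OF uH _ _ G(1) eq, unfolded l2]
  have uZ: "u \<in> Z (l + 1)" by (rule R(1)) auto
  have "nZ (l + 1) u \<le> Cell * (n0 u + nZ (l - 1) G)" by (rule R(2)) auto
  also have "\<dots> \<le> Cell * (Cemb * nH u + Cosc * (Ccont * nH u))"
    using nG inclusion_bound[OF uH] Cell_pos by (intro mult_left_mono add_mono) auto
  finally have nZu: "nZ (l + 1) u \<le> Cell * (Cemb + Cosc * Ccont) * nH u" by (simp add: algebra_simps)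
  let ?E = "energy_error_const Ccont CG1 CG2 Cemb l" and ?R = "Cell * (Cemb + Cosc * Ccont)"
  have R0: "?R \<ge> 0" using Cell_pos Cemb_pos Cosc Ccont_pos by simp
  have "ennreal (nH (u - uh)) \<le> ennreal ?E * (1 + \<eta>) * ennreal (nH (pe u))"
    using Galerkin_orthogonality[OF u uh] by (intro Galerkin_errors(2)[OF uH uhV _ mesh]) auto
  also have "\<dots> \<le> ennreal ?E * (1 + \<eta>) * (\<delta> * ennreal (?R * nH u))"
    by (intro mult_left_mono[OF order_trans[OF approximability_bound[OF uZ uH]]]
        mult_left_mono ennreal_leI nZu) auto
  also have "\<dots> = ennreal (?E * ?R) * (1 + \<eta>) * \<delta> * ennreal (nH u)"
    using ennreal_mult[OF R0, of "nH u"] ennreal_mult[OF _ R0, of ?E] nu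
    by (simp only: const_nonneg less_imp_le mult_ac)
  finally have *: "ennreal (nH (u - uh)) \<le> ennreal (?E * ?R) * (1 + \<eta>) * \<delta> * ennreal (nH u)" .
  have "ennreal (nH (u - uh) / nH u) = ennreal (nH (u - uh)) / ennreal (nH u)"
    using uH uhV nu by (simp add: divide_ennreal)
  also have "\<dots> \<le> ennreal (?E * ?R) * (1 + \<eta>) * \<delta> * ennreal (nH u) / ennreal (nH u)"
    using * by (rule divide_right_mono_ennreal)
  also have "\<dots> = ennreal (?E * ?R) * (1 + \<eta>) * \<delta>"
    using nu by (simp add: ennreal_mult_divide_eq)
  finally show ?thesis .
qed

end

section \<open>Uniform choice of the constants\<close>

theorem theorem1p5:
  fixes Ccont CG1 CG2 Cell Cemb :: real and l :: nat
  assumes "Ccont > 0" and "CG1 > 0" and "CG2 > 0" and "Cell > 0" and "Cemb > 0" and "l \<ge> 1"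
  shows "\<exists>C1 C2 C3 :: real. C1 > 0 \<and> C2 > 0 \<and> C3 > 0 \<and>
    (\<forall>(smul :: complex \<Rightarrow> 'v::ab_group_add \<Rightarrow> 'v) H0 ip0 H ipH Z nZ a Hh.
      galerkin_setting Ccont CG1 CG2 Cell Cemb l smul H0 ip0 H ipH Z nZ a Hh \<longrightarrow>
      (\<forall>h>0.
        adjoint_approximability H0 ip0 H ipH a (Hh h) *
          op_norm (Z (l + 1)) (nZ (l + 1)) (ip_norm ipH) (proj_error ipH (Hh h)) \<le> ennreal C1 \<longrightarrow>
        (\<forall>g\<in>antidual smul H ipH. \<forall>u. solves a H g u \<longrightarrow>
          (\<exists>!uh. solves a (Hh h) g uh) \<and>
          (\<forall>uh. solves a (Hh h) g uh \<longrightarrow>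
            ennreal (ip_norm ipH (u - uh))
              \<le> ennreal C2 * (1 + adjoint_approximability H0 ip0 H ipH a (Hh h)) *
                ennreal (ip_norm ipH (proj_error ipH (Hh h) u)) \<and>
            ennreal (ip_norm ip0 (u - uh))
              \<le> ennreal C3 * adjoint_approximability H0 ip0 H ipH a (Hh h) *
                ennreal (ip_norm ipH (proj_error ipH (Hh h) u)))))) \<and>
    (\<forall>Cosc>0. \<exists>C4>0.
      \<forall>(smul :: complex \<Rightarrow> 'v \<Rightarrow> 'v) H0 ip0 H ipH Z nZ a Hh.
      galerkin_setting Ccont CG1 CG2 Cell Cemb l smul H0 ip0 H ipH Z nZ a Hh \<longrightarrow>
      (\<forall>h>0.
        adjoint_approximability H0 ip0 H ipH a (Hh h) *
          op_norm (Z (l + 1)) (nZ (l + 1)) (ip_norm ipH) (proj_error ipH (Hh h)) \<le> ennreal C1 \<longrightarrow>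
        (\<forall>g\<in>antidual smul H ipH. \<forall>u uh.
          (\<exists>G\<in>Z (l - 1). (\<forall>v\<in>H. g v = ip0 G v) \<and>
            ennreal (nZ (l - 1) G) \<le> ennreal Cosc * antidual_norm H ipH g) \<longrightarrow>
          solves a H g u \<longrightarrow> solves a (Hh h) g uh \<longrightarrow>
          ennreal (ip_norm ipH (u - uh) / ip_norm ipH u)
            \<le> ennreal C4 * (1 + adjoint_approximability H0 ip0 H ipH a (Hh h)) *
              op_norm (Z (l + 1)) (nZ (l + 1)) (ip_norm ipH) (proj_error ipH (Hh h)))))"
proof -
  let ?C1 = "mesh_const Ccont CG1 CG2 Cell Cemb l"
  let ?C2 = "energy_error_const Ccont CG1 CG2 Cemb l"
  let ?C3 = "2 * duality_const Ccont CG1 CG2 Cemb l"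
  note pos = constants_pos[OF assms(1-5)]
  have discretization: "galerkin_discretization Ccont CG1 CG2 Cell Cemb l smul H0 ip0 H ipH Z nZ a Hh h"
    if "galerkin_setting Ccont CG1 CG2 Cell Cemb l smul H0 ip0 H ipH Z nZ a Hh" "h > 0"
    for smul :: "complex \<Rightarrow> 'v \<Rightarrow> 'v" and H0 ip0 H ipH Z nZ a Hh h
    using that assms
    by (simp add: galerkin_discretization_def galerkin_analysis_def galerkin_analysis_axioms_def
        galerkin_discretization_axioms_def)
  show ?thesis
  proof (rule exI[of _ ?C1], rule exI[of _ ?C2], rule exI[of _ ?C3], intro conjI allI impI ballI)
    fix smul :: "complex \<Rightarrow> 'v \<Rightarrow> 'v" and H0 ip0 H ipH Z nZ a Hh and h :: real and g u
    assume *: "galerkin_setting Ccont CG1 CG2 Cell Cemb l smul H0 ip0 H ipH Z nZ a Hh" "h > 0"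
      and mesh: "adjoint_approximability H0 ip0 H ipH a (Hh h) *
          op_norm (Z (l + 1)) (nZ (l + 1)) (ip_norm ipH) (proj_error ipH (Hh h)) \<le> ennreal ?C1"
      and g: "g \<in> antidual smul H ipH" and u: "solves a H g u"
    interpret galerkin_discretization Ccont CG1 CG2 Cell Cemb l smul H0 ip0 H ipH Z nZ a Hh h
      using * by (rule discretization)
    show "\<exists>!uh. solves a (Hh h) g uh" using g mesh by (rule Galerkin_well_posed)
    fix uh assume uh: "solves a (Hh h) g uh"
    have mem: "u \<in> H" "uh \<in> V" using u uh by (auto simp: solves_def)
    note E = Galerkin_errors[OF mem _ mesh]
    show "ennreal (ip_norm ipH (u - uh))
          \<le> ennreal ?C2 * (1 + adjoint_approximability H0 ip0 H ipH a (Hh h)) *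
            ennreal (ip_norm ipH (proj_error ipH (Hh h) u))"
      by (rule E(2)) (rule Galerkin_orthogonality[OF u uh])
    show "ennreal (ip_norm ip0 (u - uh))
          \<le> ennreal ?C3 * adjoint_approximability H0 ip0 H ipH a (Hh h) *
            ennreal (ip_norm ipH (proj_error ipH (Hh h) u))"
      by (rule E(1)) (rule Galerkin_orthogonality[OF u uh])
  next
    fix Cosc :: real assume Cosc: "Cosc > 0"
    show "\<exists>C4>0. \<forall>(smul :: complex \<Rightarrow> 'v \<Rightarrow> 'v) H0 ip0 H ipH Z nZ a Hh.
      galerkin_setting Ccont CG1 CG2 Cell Cemb l smul H0 ip0 H ipH Z nZ a Hh \<longrightarrow>
      (\<forall>h>0.
        adjoint_approximability H0 ip0 H ipH a (Hh h) *
          op_norm (Z (l + 1)) (nZ (l + 1)) (ip_norm ipH) (proj_error ipH (Hh h)) \<le> ennreal ?C1 \<longrightarrow>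
        (\<forall>g\<in>antidual smul H ipH. \<forall>u uh.
          (\<exists>G\<in>Z (l - 1). (\<forall>v\<in>H. g v = ip0 G v) \<and>
            ennreal (nZ (l - 1) G) \<le> ennreal Cosc * antidual_norm H ipH g) \<longrightarrow>
          solves a H g u \<longrightarrow> solves a (Hh h) g uh \<longrightarrow>
          ennreal (ip_norm ipH (u - uh) / ip_norm ipH u)
            \<le> ennreal C4 * (1 + adjoint_approximability H0 ip0 H ipH a (Hh h)) *
              op_norm (Z (l + 1)) (nZ (l + 1)) (ip_norm ipH) (proj_error ipH (Hh h))))"
    \<comment> \<open>The factor after \<open>?C2\<close> bounds the \<open>Z (l + 1)\<close> norm
      of \<open>u\<close> relative to \<open>nH u\<close>.\<close>
    proof (rule exI[of _ "?C2 * (Cell * (Cemb + Cosc * Ccont))"], intro conjI allI impI ballI)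
      show "?C2 * (Cell * (Cemb + Cosc * Ccont)) > 0"
        using pos(5) assms Cosc by (simp add: add_pos_pos)
    next
      fix smul :: "complex \<Rightarrow> 'v \<Rightarrow> 'v" and H0 ip0 H ipH Z nZ a Hh and h :: real and g u uh
      assume *: "galerkin_setting Ccont CG1 CG2 Cell Cemb l smul H0 ip0 H ipH Z nZ a Hh" "h > 0"
        and mesh: "adjoint_approximability H0 ip0 H ipH a (Hh h) *
          op_norm (Z (l + 1)) (nZ (l + 1)) (ip_norm ipH) (proj_error ipH (Hh h)) \<le> ennreal ?C1"
        and g: "g \<in> antidual smul H ipH"
        and osc: "\<exists>G\<in>Z (l - 1). (\<forall>v\<in>H. g v = ip0 G v) \<and>
            ennreal (nZ (l - 1) G) \<le> ennreal Cosc * antidual_norm H ipH g"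
        and u: "solves a H g u" and uh: "solves a (Hh h) g uh"
      interpret galerkin_discretization Ccont CG1 CG2 Cell Cemb l smul H0 ip0 H ipH Z nZ a Hh h
        using * by (rule discretization)
      obtain G where "G \<in> Z (l - 1)" "\<And>v. v \<in> H \<Longrightarrow> g v = ip0 G v"
          "ennreal (nZ (l - 1) G) \<le> ennreal Cosc * antidual_norm H ipH g"
        using osc by blast
      then show "ennreal (ip_norm ipH (u - uh) / ip_norm ipH u)
            \<le> ennreal (?C2 * (Cell * (Cemb + Cosc * Ccont))) *
                (1 + adjoint_approximability H0 ip0 H ipH a (Hh h)) *
              op_norm (Z (l + 1)) (nZ (l + 1)) (ip_norm ipH) (proj_error ipH (Hh h))"
        by (rule relative_error[OF u uh _ _ _ Cosc mesh])
    qed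
  qed (use pos in auto)
qed

end
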